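(* Let $(!,\delta,\varepsilon,\Delta,e,\nabla,u)$ be an additive bialgebra modality on an additive symmetric monoidal category. Define $$m_\otimes := (\delta\otimes\delta)\,\big(!(1\otimes u)\otimes !(u\otimes 1)\big)\,\nabla\,\delta\; !(\Delta)\; !\big(!(\varepsilon\otimes e)\otimes !(e\otimes\varepsilon)\big)\; !(\varepsilon\otimes\varepsilon): {!A}\otimes{!B}\to {!(A\otimes B)},$$ $$m_K := u\,\delta\, !(e): K\to {!K},$$ where the intermediate objects of $m_\otimes$ are, in order, ${!!A}\otimes{!!B}$, ${!({!A}\otimes{!B})}\otimes{!({!A}\otimes{!B})}$, ${!({!A}\otimes{!B})}$, ${!!({!A}\otimes{!B})}$, ${!\big({!({!A}\otimes{!B})}\otimes{!({!A}\otimes{!B})}\big)}$, ${!({!A}\otimes{!B})}$. Then $(!,\delta,\varepsilon,m_\otimes,m_K,\Delta,e)$ is a monoidal coalgebra modality.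
   Context: Composition is in diagrammatic order ($fg$ means first $f$, then $g$). Symmetric monoidal categories are treated as strict (associators and unitors suppressed), with tensor $\otimes$, unit $K$, symmetry $\sigma:A\otimes B\to B\otimes A$. An additive symmetric monoidal category is a symmetric monoidal category enriched in commutative monoids (hom-sets have $+$ and $0$, no negatives, no biproducts assumed), with composition and $\otimes$ preserving $+$ and $0$ in each variable. A coalgebra modality $(!,\delta,\varepsilon,\Delta,e)$ is a comonad $(!,\delta,\varepsilon)$, $\delta:{!A}\to{!!A}$, $\varepsilon:{!A}\to A$, with natural transformations $\Delta:{!A}\to{!A}\otimes{!A}$, $e:{!A}\to K$ such that each $({!A},\Delta,e)$ is a cocommutative comonoid and $\delta\Delta=\Delta(\delta\otimes\delta)$. A bialgebra modality $(!,\delta,\varepsilon,\Delta,e,\nabla,u)$ is a coalgebra modality with natural transformations $\nabla:{!A}\otimes{!A}\to{!A}$, $u:K\to{!A}$ such that $({!A},\nabla,u)$ is a commutative monoid, $\nabla e=e\otimes e$, $u\Delta=u\otimes u$, $ue=1$, $\nabla\Delta=(\Delta\otimes\Delta)(1\otimes\sigma\otimes1)(\nabla\otimes\nabla)$, and $\nabla\varepsilon=\varepsilon\otimes e+e\otimes\varepsilon$. It is additive if for all parallel maps $f,g$: $!(f+g)=\Delta(!(f)\otimes!(g))\nabla$ and $!(0)=eu$. A monoidal coalgebra modality $(!,\delta,\varepsilon,m_\otimes,m_K,\Delta,e)$ is a coalgebra modality with a natural transformation $m_\otimes:{!A}\otimes{!B}\to{!(A\otimes B)}$ and a map $m_K:K\to{!K}$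 such that: $(!,m_\otimes,m_K)$ is a (lax) symmetric monoidal endofunctor; $\delta,\varepsilon$ are monoidal: $m_\otimes\delta=(\delta\otimes\delta)m_\otimes!(m_\otimes)$, $m_K\delta=m_K!(m_K)$, $m_\otimes\varepsilon=\varepsilon\otimes\varepsilon$, $m_K\varepsilon=1$; $\Delta,e$ are monoidal: $m_\otimes\Delta=(\Delta\otimes\Delta)(1\otimes\sigma\otimes1)(m_\otimes\otimes m_\otimes)$, $m_\otimes e=e\otimes e$, $m_K\Delta=m_K\otimes m_K$, $m_Ke=1$; and $\Delta,e$ are $!$-coalgebra morphisms: $\delta\,!(\Delta)=\Delta(\delta\otimes\delta)m_\otimes$, $\delta\,!(e)=e\,m_K$. *)

theory Defs
  imports Main
begin

text \<open>
  Objects and arrows are elements of explicit carriers, and composition is written in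
  diagrammatic order.  Monoidal categories are strict: the associativity and unit laws of the
  tensor are equations between objects and between arrows.  Operations are only constrained on
  objects and (composable, parallel) arrows of the category.
\<close>

record ('o, 'm) smc_data =
  Ob :: "'o set"
  Arr :: "'m set"
  src :: "'m \<Rightarrow> 'o"
  trg :: "'m \<Rightarrow> 'o"
  ident :: "'o \<Rightarrow> 'm" ("\<one>\<index>")
  cmp :: "'m \<Rightarrow> 'm \<Rightarrow> 'm" (infixl "\<Zcomp>\<index>" 65)
  tens_ob :: "'o \<Rightarrow> 'o \<Rightarrow> 'o" (infixl "\<otimes>\<^sub>o\<index>" 70)
  tens :: "'m \<Rightarrow> 'm \<Rightarrow> 'm" (infixl "\<otimes>\<index>" 70)
  unit_ob :: "'o" ("\<K>\<index>")
  symm :: "'o \<Rightarrow> 'o \<Rightarrow> 'm" ("\<sigma>\<index>")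

record ('o, 'm) additive_smc_data = "('o, 'm) smc_data" +
  add :: "'m \<Rightarrow> 'm \<Rightarrow> 'm" (infixl "\<oplus>\<index>" 60)
  zero :: "'o \<Rightarrow> 'o \<Rightarrow> 'm" ("\<zero>\<index>")

definition hom :: "('o, 'm, 'x) smc_data_scheme \<Rightarrow> 'o \<Rightarrow> 'o \<Rightarrow> 'm set" where
  "hom C A B = {f \<in> Arr C. src C f = A \<and> trg C f = B}"

locale category =
  fixes C :: "('o, 'm, 'x) smc_data_scheme" (structure)
  assumes src_ob: "f \<in> Arr C \<Longrightarrow> src C f \<in> Ob C"
    and trg_ob: "f \<in> Arr C \<Longrightarrow> trg C f \<in> Ob C"
    and ident_hom: "A \<in> Ob C \<Longrightarrow> \<one> A \<in> hom C A A"
    and cmp_hom: "\<lbrakk>f \<in> hom C A B; g \<in> hom C B D\<rbrakk> \<Longrightarrow> f \<Zcomp> g \<in> hom C A D"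
    and ident_left: "f \<in> hom C A B \<Longrightarrow> \<one> A \<Zcomp> f = f"
    and ident_right: "f \<in> hom C A B \<Longrightarrow> f \<Zcomp> \<one> B = f"
    and cmp_assoc:
      "\<lbrakk>f \<in> hom C A B; g \<in> hom C B D; h \<in> hom C D E\<rbrakk> \<Longrightarrow> (f \<Zcomp> g) \<Zcomp> h = f \<Zcomp> (g \<Zcomp> h)"

locale symmetric_monoidal_category = category C
  for C :: "('o, 'm, 'x) smc_data_scheme" (structure) +
  assumes unit_ob: "\<K> \<in> Ob C"
    and tens_ob: "\<lbrakk>A \<in> Ob C; B \<in> Ob C\<rbrakk> \<Longrightarrow> A \<otimes>\<^sub>o B \<in> Ob C"
    and tens_ob_assoc:
      "\<lbrakk>A \<in> Ob C; B \<in> Ob C; D \<in> Ob C\<rbrakk> \<Longrightarrow> (A \<otimes>\<^sub>o B) \<otimes>\<^sub>o D = A \<otimes>\<^sub>o (B \<otimes>\<^sub>o D)"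
    and tens_ob_unit_left: "A \<in> Ob C \<Longrightarrow> \<K> \<otimes>\<^sub>o A = A"
    and tens_ob_unit_right: "A \<in> Ob C \<Longrightarrow> A \<otimes>\<^sub>o \<K> = A"
    and tens_hom:
      "\<lbrakk>f \<in> hom C A B; g \<in> hom C A' B'\<rbrakk> \<Longrightarrow> f \<otimes> g \<in> hom C (A \<otimes>\<^sub>o A') (B \<otimes>\<^sub>o B')"
    and tens_ident: "\<lbrakk>A \<in> Ob C; B \<in> Ob C\<rbrakk> \<Longrightarrow> \<one> A \<otimes> \<one> B = \<one> (A \<otimes>\<^sub>o B)"
    and tens_cmp:
      "\<lbrakk>f \<in> hom C A B; g \<in> hom C B D; f' \<in> hom C A' B'; g' \<in> hom C B' D'\<rbrakk>
        \<Longrightarrow> (f \<Zcomp> g) \<otimes> (f' \<Zcomp> g') = (f \<otimes> f') \<Zcomp> (g \<otimes> g')"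
    and tens_assoc:
      "\<lbrakk>f \<in> Arr C; g \<in> Arr C; h \<in> Arr C\<rbrakk> \<Longrightarrow> (f \<otimes> g) \<otimes> h = f \<otimes> (g \<otimes> h)"
    and tens_unit_left: "f \<in> Arr C \<Longrightarrow> \<one> \<K> \<otimes> f = f"
    and tens_unit_right: "f \<in> Arr C \<Longrightarrow> f \<otimes> \<one> \<K> = f"
    and symm_hom: "\<lbrakk>A \<in> Ob C; B \<in> Ob C\<rbrakk> \<Longrightarrow> \<sigma> A B \<in> hom C (A \<otimes>\<^sub>o B) (B \<otimes>\<^sub>o A)"
    and symm_natural:
      "\<lbrakk>f \<in> hom C A B; g \<in> hom C A' B'\<rbrakk> \<Longrightarrow> (f \<otimes> g) \<Zcomp> \<sigma> B B' = \<sigma> A A' \<Zcomp> (g \<otimes> f)"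
    and symm_symm: "\<lbrakk>A \<in> Ob C; B \<in> Ob C\<rbrakk> \<Longrightarrow> \<sigma> A B \<Zcomp> \<sigma> B A = \<one> (A \<otimes>\<^sub>o B)"
    and symm_unit: "A \<in> Ob C \<Longrightarrow> \<sigma> A \<K> = \<one> A"
    and symm_hexagon:
      "\<lbrakk>A \<in> Ob C; B \<in> Ob C; D \<in> Ob C\<rbrakk>
        \<Longrightarrow> \<sigma> A (B \<otimes>\<^sub>o D) = (\<sigma> A B \<otimes> \<one> D) \<Zcomp> (\<one> B \<otimes> \<sigma> A D)"

locale additive_symmetric_monoidal_category = symmetric_monoidal_category C
  for C :: "('o, 'm, 'x) additive_smc_data_scheme" (structure) +
  assumes zero_hom: "\<lbrakk>A \<in> Ob C; B \<in> Ob C\<rbrakk> \<Longrightarrow> \<zero> A B \<in> hom C A B"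
    and add_hom: "\<lbrakk>f \<in> hom C A B; g \<in> hom C A B\<rbrakk> \<Longrightarrow> f \<oplus> g \<in> hom C A B"
    and add_assoc:
      "\<lbrakk>f \<in> hom C A B; g \<in> hom C A B; h \<in> hom C A B\<rbrakk> \<Longrightarrow> (f \<oplus> g) \<oplus> h = f \<oplus> (g \<oplus> h)"
    and add_commute: "\<lbrakk>f \<in> hom C A B; g \<in> hom C A B\<rbrakk> \<Longrightarrow> f \<oplus> g = g \<oplus> f"
    and add_zero: "f \<in> hom C A B \<Longrightarrow> f \<oplus> \<zero> A B = f"
    and cmp_add_left:
      "\<lbrakk>f \<in> hom C A B; g \<in> hom C A B; h \<in> hom C B D\<rbrakk>
        \<Longrightarrow> (f \<oplus> g) \<Zcomp> h = (f \<Zcomp> h) \<oplus> (g \<Zcomp> h)"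
    and cmp_add_right:
      "\<lbrakk>f \<in> hom C A B; g \<in> hom C B D; h \<in> hom C B D\<rbrakk>
        \<Longrightarrow> f \<Zcomp> (g \<oplus> h) = (f \<Zcomp> g) \<oplus> (f \<Zcomp> h)"
    and cmp_zero_left: "\<lbrakk>A \<in> Ob C; h \<in> hom C B D\<rbrakk> \<Longrightarrow> \<zero> A B \<Zcomp> h = \<zero> A D"
    and cmp_zero_right: "\<lbrakk>f \<in> hom C A B; D \<in> Ob C\<rbrakk> \<Longrightarrow> f \<Zcomp> \<zero> B D = \<zero> A D"
    and tens_add_left:
      "\<lbrakk>f \<in> hom C A B; g \<in> hom C A B; h \<in> hom C A' B'\<rbrakk>
        \<Longrightarrow> (f \<oplus> g) \<otimes> h = (f \<otimes> h) \<oplus> (g \<otimes> h)"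
    and tens_add_right:
      "\<lbrakk>f \<in> hom C A B; g \<in> hom C A' B'; h \<in> hom C A' B'\<rbrakk>
        \<Longrightarrow> f \<otimes> (g \<oplus> h) = (f \<otimes> g) \<oplus> (f \<otimes> h)"
    and tens_zero_left:
      "\<lbrakk>A \<in> Ob C; B \<in> Ob C; h \<in> hom C A' B'\<rbrakk>
        \<Longrightarrow> \<zero> A B \<otimes> h = \<zero> (A \<otimes>\<^sub>o A') (B \<otimes>\<^sub>o B')"
    and tens_zero_right:
      "\<lbrakk>f \<in> hom C A B; A' \<in> Ob C; B' \<in> Ob C\<rbrakk>
        \<Longrightarrow> f \<otimes> \<zero> A' B' = \<zero> (A \<otimes>\<^sub>o A') (B \<otimes>\<^sub>o B')"

text \<open>
  The functor \<open>!\<close> is given by its object part \<open>bang\<^sub>o\<close> and its arrow part \<open>bang\<close>; a natural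
  transformation is given by its family of components.
\<close>

locale endofunctor = category C
  for C :: "('o, 'm, 'x) smc_data_scheme" (structure)
    and bang\<^sub>o :: "'o \<Rightarrow> 'o" and bang :: "'m \<Rightarrow> 'm" +
  assumes bang_ob: "A \<in> Ob C \<Longrightarrow> bang\<^sub>o A \<in> Ob C"
    and bang_hom: "f \<in> hom C A B \<Longrightarrow> bang f \<in> hom C (bang\<^sub>o A) (bang\<^sub>o B)"
    and bang_ident: "A \<in> Ob C \<Longrightarrow> bang (\<one> A) = \<one> (bang\<^sub>o A)"
    and bang_cmp:
      "\<lbrakk>f \<in> hom C A B; g \<in> hom C B D\<rbrakk> \<Longrightarrow> bang (f \<Zcomp> g) = bang f \<Zcomp> bang g"

locale comonad = endofunctor C bang\<^sub>o bang
  for C :: "('o, 'm, 'x) smc_data_scheme" (structure)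
    and bang\<^sub>o :: "'o \<Rightarrow> 'o" and bang :: "'m \<Rightarrow> 'm" +
  fixes \<delta> :: "'o \<Rightarrow> 'm" and \<epsilon> :: "'o \<Rightarrow> 'm"
  assumes \<delta>_hom: "A \<in> Ob C \<Longrightarrow> \<delta> A \<in> hom C (bang\<^sub>o A) (bang\<^sub>o (bang\<^sub>o A))"
    and \<delta>_natural: "f \<in> hom C A B \<Longrightarrow> bang f \<Zcomp> \<delta> B = \<delta> A \<Zcomp> bang (bang f)"
    and \<epsilon>_hom: "A \<in> Ob C \<Longrightarrow> \<epsilon> A \<in> hom C (bang\<^sub>o A) A"
    and \<epsilon>_natural: "f \<in> hom C A B \<Longrightarrow> bang f \<Zcomp> \<epsilon> B = \<epsilon> A \<Zcomp> f"
    and \<delta>_\<epsilon>: "A \<in> Ob C \<Longrightarrow> \<delta> A \<Zcomp> \<epsilon> (bang\<^sub>o A) = \<one> (bang\<^sub>o A)"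
    and \<delta>_bang_\<epsilon>: "A \<in> Ob C \<Longrightarrow> \<delta> A \<Zcomp> bang (\<epsilon> A) = \<one> (bang\<^sub>o A)"
    and \<delta>_\<delta>: "A \<in> Ob C \<Longrightarrow> \<delta> A \<Zcomp> \<delta> (bang\<^sub>o A) = \<delta> A \<Zcomp> bang (\<delta> A)"

locale coalgebra_modality =
  symmetric_monoidal_category C + comonad C bang\<^sub>o bang \<delta> \<epsilon>
  for C :: "('o, 'm, 'x) smc_data_scheme" (structure)
    and bang\<^sub>o :: "'o \<Rightarrow> 'o" and bang :: "'m \<Rightarrow> 'm"
    and \<delta> :: "'o \<Rightarrow> 'm" and \<epsilon> :: "'o \<Rightarrow> 'm" +
  fixes \<Delta> :: "'o \<Rightarrow> 'm" and e :: "'o \<Rightarrow> 'm"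
  assumes \<Delta>_hom: "A \<in> Ob C \<Longrightarrow> \<Delta> A \<in> hom C (bang\<^sub>o A) (bang\<^sub>o A \<otimes>\<^sub>o bang\<^sub>o A)"
    and \<Delta>_natural: "f \<in> hom C A B \<Longrightarrow> bang f \<Zcomp> \<Delta> B = \<Delta> A \<Zcomp> (bang f \<otimes> bang f)"
    and e_hom: "A \<in> Ob C \<Longrightarrow> e A \<in> hom C (bang\<^sub>o A) \<K>"
    and e_natural: "f \<in> hom C A B \<Longrightarrow> bang f \<Zcomp> e B = e A"
    and \<Delta>_coassoc:
      "A \<in> Ob C \<Longrightarrow> \<Delta> A \<Zcomp> (\<Delta> A \<otimes> \<one> (bang\<^sub>o A)) = \<Delta> A \<Zcomp> (\<one> (bang\<^sub>o A) \<otimes> \<Delta> A)"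
    and \<Delta>_counit_left: "A \<in> Ob C \<Longrightarrow> \<Delta> A \<Zcomp> (e A \<otimes> \<one> (bang\<^sub>o A)) = \<one> (bang\<^sub>o A)"
    and \<Delta>_counit_right: "A \<in> Ob C \<Longrightarrow> \<Delta> A \<Zcomp> (\<one> (bang\<^sub>o A) \<otimes> e A) = \<one> (bang\<^sub>o A)"
    and \<Delta>_cocommute: "A \<in> Ob C \<Longrightarrow> \<Delta> A \<Zcomp> \<sigma> (bang\<^sub>o A) (bang\<^sub>o A) = \<Delta> A"
    and \<delta>_\<Delta>: "A \<in> Ob C \<Longrightarrow> \<delta> A \<Zcomp> \<Delta> (bang\<^sub>o A) = \<Delta> A \<Zcomp> (\<delta> A \<otimes> \<delta> A)"

locale bialgebra_modality =
  additive_symmetric_monoidal_category C + coalgebra_modality C bang\<^sub>o bang \<delta> \<epsilon> \<Delta> e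
  for C :: "('o, 'm, 'x) additive_smc_data_scheme" (structure)
    and bang\<^sub>o :: "'o \<Rightarrow> 'o" and bang :: "'m \<Rightarrow> 'm"
    and \<delta> :: "'o \<Rightarrow> 'm" and \<epsilon> :: "'o \<Rightarrow> 'm"
    and \<Delta> :: "'o \<Rightarrow> 'm" and e :: "'o \<Rightarrow> 'm" +
  fixes nabla :: "'o \<Rightarrow> 'm" ("\<nabla>") and u :: "'o \<Rightarrow> 'm"
  assumes nabla_hom: "A \<in> Ob C \<Longrightarrow> \<nabla> A \<in> hom C (bang\<^sub>o A \<otimes>\<^sub>o bang\<^sub>o A) (bang\<^sub>o A)"
    and nabla_natural: "f \<in> hom C A B \<Longrightarrow> (bang f \<otimes> bang f) \<Zcomp> \<nabla> B = \<nabla> A \<Zcomp> bang f"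
    and u_hom: "A \<in> Ob C \<Longrightarrow> u A \<in> hom C \<K> (bang\<^sub>o A)"
    and u_natural: "f \<in> hom C A B \<Longrightarrow> u A \<Zcomp> bang f = u B"
    and nabla_assoc:
      "A \<in> Ob C \<Longrightarrow> (\<nabla> A \<otimes> \<one> (bang\<^sub>o A)) \<Zcomp> \<nabla> A = (\<one> (bang\<^sub>o A) \<otimes> \<nabla> A) \<Zcomp> \<nabla> A"
    and nabla_unit_left: "A \<in> Ob C \<Longrightarrow> (u A \<otimes> \<one> (bang\<^sub>o A)) \<Zcomp> \<nabla> A = \<one> (bang\<^sub>o A)"
    and nabla_unit_right: "A \<in> Ob C \<Longrightarrow> (\<one> (bang\<^sub>o A) \<otimes> u A) \<Zcomp> \<nabla> A = \<one> (bang\<^sub>o A)"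
    and nabla_commute: "A \<in> Ob C \<Longrightarrow> \<sigma> (bang\<^sub>o A) (bang\<^sub>o A) \<Zcomp> \<nabla> A = \<nabla> A"
    and nabla_e: "A \<in> Ob C \<Longrightarrow> \<nabla> A \<Zcomp> e A = e A \<otimes> e A"
    and u_\<Delta>: "A \<in> Ob C \<Longrightarrow> u A \<Zcomp> \<Delta> A = u A \<otimes> u A"
    and u_e: "A \<in> Ob C \<Longrightarrow> u A \<Zcomp> e A = \<one> \<K>"
    and nabla_\<Delta>:
      "A \<in> Ob C \<Longrightarrow> \<nabla> A \<Zcomp> \<Delta> A =
        (\<Delta> A \<otimes> \<Delta> A) \<Zcomp> (\<one> (bang\<^sub>o A) \<otimes> \<sigma> (bang\<^sub>o A) (bang\<^sub>o A) \<otimes> \<one> (bang\<^sub>o A))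
          \<Zcomp> (\<nabla> A \<otimes> \<nabla> A)"
    and nabla_\<epsilon>: "A \<in> Ob C \<Longrightarrow> \<nabla> A \<Zcomp> \<epsilon> A = (\<epsilon> A \<otimes> e A) \<oplus> (e A \<otimes> \<epsilon> A)"

locale additive_bialgebra_modality = bialgebra_modality C bang\<^sub>o bang \<delta> \<epsilon> \<Delta> e nabla u
  for C :: "('o, 'm, 'x) additive_smc_data_scheme" (structure)
    and bang\<^sub>o :: "'o \<Rightarrow> 'o" and bang :: "'m \<Rightarrow> 'm"
    and \<delta> :: "'o \<Rightarrow> 'm" and \<epsilon> :: "'o \<Rightarrow> 'm"
    and \<Delta> :: "'o \<Rightarrow> 'm" and e :: "'o \<Rightarrow> 'm"
    and nabla :: "'o \<Rightarrow> 'm" ("\<nabla>") and u :: "'o \<Rightarrow> 'm" +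
  assumes bang_add:
      "\<lbrakk>f \<in> hom C A B; g \<in> hom C A B\<rbrakk>
        \<Longrightarrow> bang (f \<oplus> g) = \<Delta> A \<Zcomp> (bang f \<otimes> bang g) \<Zcomp> \<nabla> B"
    and bang_zero: "\<lbrakk>A \<in> Ob C; B \<in> Ob C\<rbrakk> \<Longrightarrow> bang (\<zero> A B) = e A \<Zcomp> u B"

locale lax_symmetric_monoidal_endofunctor =
  symmetric_monoidal_category C + endofunctor C bang\<^sub>o bang
  for C :: "('o, 'm, 'x) smc_data_scheme" (structure)
    and bang\<^sub>o :: "'o \<Rightarrow> 'o" and bang :: "'m \<Rightarrow> 'm" +
  fixes m :: "'o \<Rightarrow> 'o \<Rightarrow> 'm" and m\<^sub>K :: "'m"
  assumes m_hom:
      "\<lbrakk>A \<in> Ob C; B \<in> Ob C\<rbrakk> \<Longrightarrow> m A B \<in> hom C (bang\<^sub>o A \<otimes>\<^sub>o bang\<^sub>o B) (bang\<^sub>o (A \<otimes>\<^sub>o B))"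
    and m_natural:
      "\<lbrakk>f \<in> hom C A B; g \<in> hom C A' B'\<rbrakk>
        \<Longrightarrow> (bang f \<otimes> bang g) \<Zcomp> m B B' = m A A' \<Zcomp> bang (f \<otimes> g)"
    and m\<^sub>K_hom: "m\<^sub>K \<in> hom C \<K> (bang\<^sub>o \<K>)"
    and m_assoc:
      "\<lbrakk>A \<in> Ob C; B \<in> Ob C; D \<in> Ob C\<rbrakk>
        \<Longrightarrow> (m A B \<otimes> \<one> (bang\<^sub>o D)) \<Zcomp> m (A \<otimes>\<^sub>o B) D = (\<one> (bang\<^sub>o A) \<otimes> m B D) \<Zcomp> m A (B \<otimes>\<^sub>o D)"
    and m_unit_left: "A \<in> Ob C \<Longrightarrow> (m\<^sub>K \<otimes> \<one> (bang\<^sub>o A)) \<Zcomp> m \<K> A = \<one> (bang\<^sub>o A)"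
    and m_unit_right: "A \<in> Ob C \<Longrightarrow> (\<one> (bang\<^sub>o A) \<otimes> m\<^sub>K) \<Zcomp> m A \<K> = \<one> (bang\<^sub>o A)"
    and m_symm:
      "\<lbrakk>A \<in> Ob C; B \<in> Ob C\<rbrakk>
        \<Longrightarrow> m A B \<Zcomp> bang (\<sigma> A B) = \<sigma> (bang\<^sub>o A) (bang\<^sub>o B) \<Zcomp> m B A"

locale monoidal_coalgebra_modality =
  coalgebra_modality C bang\<^sub>o bang \<delta> \<epsilon> \<Delta> e +
  lax_symmetric_monoidal_endofunctor C bang\<^sub>o bang m m\<^sub>K
  for C :: "('o, 'm, 'x) smc_data_scheme" (structure)
    and bang\<^sub>o :: "'o \<Rightarrow> 'o" and bang :: "'m \<Rightarrow> 'm"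
    and \<delta> :: "'o \<Rightarrow> 'm" and \<epsilon> :: "'o \<Rightarrow> 'm"
    and m :: "'o \<Rightarrow> 'o \<Rightarrow> 'm" and m\<^sub>K :: "'m"
    and \<Delta> :: "'o \<Rightarrow> 'm" and e :: "'o \<Rightarrow> 'm" +
  assumes m_\<delta>:
      "\<lbrakk>A \<in> Ob C; B \<in> Ob C\<rbrakk>
        \<Longrightarrow> m A B \<Zcomp> \<delta> (A \<otimes>\<^sub>o B) = (\<delta> A \<otimes> \<delta> B) \<Zcomp> m (bang\<^sub>o A) (bang\<^sub>o B) \<Zcomp> bang (m A B)"
    and m\<^sub>K_\<delta>: "m\<^sub>K \<Zcomp> \<delta> \<K> = m\<^sub>K \<Zcomp> bang m\<^sub>K"
    and m_\<epsilon>: "\<lbrakk>A \<in> Ob C; B \<in> Ob C\<rbrakk> \<Longrightarrow> m A B \<Zcomp> \<epsilon> (A \<otimes>\<^sub>o B) = \<epsilon> A \<otimes> \<epsilon> B"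
    and m\<^sub>K_\<epsilon>: "m\<^sub>K \<Zcomp> \<epsilon> \<K> = \<one> \<K>"
    and m_\<Delta>:
      "\<lbrakk>A \<in> Ob C; B \<in> Ob C\<rbrakk>
        \<Longrightarrow> m A B \<Zcomp> \<Delta> (A \<otimes>\<^sub>o B) =
          (\<Delta> A \<otimes> \<Delta> B) \<Zcomp> (\<one> (bang\<^sub>o A) \<otimes> \<sigma> (bang\<^sub>o A) (bang\<^sub>o B) \<otimes> \<one> (bang\<^sub>o B))
            \<Zcomp> (m A B \<otimes> m A B)"
    and m_e: "\<lbrakk>A \<in> Ob C; B \<in> Ob C\<rbrakk> \<Longrightarrow> m A B \<Zcomp> e (A \<otimes>\<^sub>o B) = e A \<otimes> e B"
    and m\<^sub>K_\<Delta>: "m\<^sub>K \<Zcomp> \<Delta> \<K> = m\<^sub>K \<otimes> m\<^sub>K"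
    and m\<^sub>K_e: "m\<^sub>K \<Zcomp> e \<K> = \<one> \<K>"
    and \<Delta>_coalgebra:
      "A \<in> Ob C \<Longrightarrow> \<delta> A \<Zcomp> bang (\<Delta> A) = \<Delta> A \<Zcomp> (\<delta> A \<otimes> \<delta> A) \<Zcomp> m (bang\<^sub>o A) (bang\<^sub>o A)"
    and e_coalgebra: "A \<in> Ob C \<Longrightarrow> \<delta> A \<Zcomp> bang (e A) = e A \<Zcomp> m\<^sub>K"

text \<open>
  In \<open>m_K\<close> the component of \<open>u\<close>, \<open>\<delta>\<close> and \<open>e\<close> is taken at the unit object.  Since
  \<open>u\<close>, \<open>\<delta>\<close> and \<open>e\<close> are natural and zero maps exist, every other object gives the same map.
\<close>

definition m_tensor ::
  "('o, 'm, 'x) smc_data_scheme \<Rightarrow> ('o \<Rightarrow> 'o) \<Rightarrow> ('m \<Rightarrow> 'm) \<Rightarrow> ('o \<Rightarrow> 'm) \<Rightarrow> ('o \<Rightarrow> 'm) \<Rightarrow>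
    ('o \<Rightarrow> 'm) \<Rightarrow> ('o \<Rightarrow> 'm) \<Rightarrow> ('o \<Rightarrow> 'm) \<Rightarrow> ('o \<Rightarrow> 'm) \<Rightarrow> 'o \<Rightarrow> 'o \<Rightarrow> 'm"
  where
  "m_tensor C bang\<^sub>o bang \<delta> \<epsilon> \<Delta> e nabla u A B =
    (let X = bang\<^sub>o A \<otimes>\<^sub>o bang\<^sub>o B in
      (\<delta> A \<otimes> \<delta> B)
      \<Zcomp> (bang (\<one> (bang\<^sub>o A) \<otimes> u B) \<otimes> bang (u A \<otimes> \<one> (bang\<^sub>o B)))
      \<Zcomp> nabla X
      \<Zcomp> \<delta> X
      \<Zcomp> bang (\<Delta> X)
      \<Zcomp> bang (bang (\<epsilon> A \<otimes> e B) \<otimes> bang (e A \<otimes> \<epsilon> B))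
      \<Zcomp> bang (\<epsilon> A \<otimes> \<epsilon> B))" for C (structure)

definition m_K ::
  "('o, 'm, 'x) smc_data_scheme \<Rightarrow> ('m \<Rightarrow> 'm) \<Rightarrow> ('o \<Rightarrow> 'm) \<Rightarrow> ('o \<Rightarrow> 'm) \<Rightarrow> ('o \<Rightarrow> 'm) \<Rightarrow> 'm"
  where
  "m_K C bang \<delta> e u = u \<K> \<Zcomp> \<delta> \<K> \<Zcomp> bang (e \<K>)" for C (structure)

end

theory Submission
  imports Defs
begin

text \<open>
  If biproducts existed, \<open>!A \<otimes> !B\<close> would be the cofree coalgebra \<open>!(A \<times> B)\<close> (the Seely
  isomorphism).  Without them, \<open>!A \<otimes> !B\<close> is still a retract of the cofree coalgebra
  \<open>!(!A \<otimes> !B)\<close> through \<open>seely_in\<close> and \<open>seely_out\<close>, and this retraction makes it a coalgebra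
  with structure \<open>d = seely_in \<delta> !(seely_out)\<close>.  Then \<open>m\<^sub>\<otimes> = d !(\<epsilon> \<otimes> \<epsilon>)\<close>, and the axioms for
  \<open>m\<^sub>\<otimes>\<close> reduce to the statement that \<open>h \<otimes> k\<close>, \<open>\<sigma>\<close> and \<open>\<Delta>\<close> are coalgebra morphisms for \<open>d\<close>.
  Since \<open>seely_in\<close> is split monic, this only has to be checked after composing with \<open>seely_in\<close>,
  where additivity of \<open>!\<close> and \<open>u \<epsilon> = 0\<close> give the result.  Associativity holds because the two
  coalgebra structures on \<open>!A \<otimes> !B \<otimes> !D\<close> are induced by the same threefold retraction.
\<close>

section \<open>Typing of arrows and right-nested composites\<close>

context category
begin

text \<open>Splitting membership into three facts lets sources and targets be computed by
  rewriting.\<close>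

lemma mem_hom_iff [simp]: "f \<in> hom C A B \<longleftrightarrow> f \<in> Arr C \<and> src C f = A \<and> trg C f = B"
  by (auto simp: hom_def)

lemma ob_src_trg [simp]:
  assumes "f \<in> Arr C"
  shows "src C f \<in> Ob C" "trg C f \<in> Ob C"
  using assms src_ob trg_ob by auto

lemma ident_type [simp]:
  assumes "A \<in> Ob C"
  shows "\<one> A \<in> Arr C" "src C (\<one> A) = A" "trg C (\<one> A) = A"
  using ident_hom[OF assms] by auto

lemma cmp_type [simp]:
  assumes "f \<in> Arr C" "g \<in> Arr C" "trg C f = src C g"
  shows "f \<Zcomp> g \<in> Arr C" "src C (f \<Zcomp> g) = src C f" "trg C (f \<Zcomp> g) = trg C g"
  using cmp_hom[of f "src C f" "trg C f" g "trg C g"] assms by auto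

lemma cmp_ident [simp]:
  "\<lbrakk>f \<in> Arr C; src C f = A\<rbrakk> \<Longrightarrow> \<one> A \<Zcomp> f = f"
  "\<lbrakk>f \<in> Arr C; trg C f = B\<rbrakk> \<Longrightarrow> f \<Zcomp> \<one> B = f"
  using ident_left[of f A "trg C f"] ident_right[of f "src C f" B] by auto

lemma cmp_assoc_right [simp]:
  "\<lbrakk>f \<in> Arr C; g \<in> Arr C; h \<in> Arr C; trg C f = src C g; trg C g = src C h\<rbrakk>
    \<Longrightarrow> (f \<Zcomp> g) \<Zcomp> h = f \<Zcomp> (g \<Zcomp> h)"
  using cmp_assoc[of f _ _ g _ h] by auto

text \<open>
  Composites are normalised to the right, so a law \<open>f \<Zcomp> g = k\<close> must also be available
  in front of a remaining tail: \<open>law[THEN cmp_tail]\<close>.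
\<close>

lemma cmp_tail:
  assumes "f \<Zcomp> g = k" "f \<in> Arr C" "g \<in> Arr C" "h \<in> Arr C" "trg C f = src C g" "trg C g = src C h"
  shows "f \<Zcomp> (g \<Zcomp> h) = k \<Zcomp> h"
  using assms cmp_assoc_right by metis

end

section \<open>Rewriting in a strict symmetric monoidal category\<close>

context symmetric_monoidal_category
begin

lemma tens_ob_rules [simp]:
  "\<K> \<in> Ob C"
  "\<lbrakk>A \<in> Ob C; B \<in> Ob C\<rbrakk> \<Longrightarrow> A \<otimes>\<^sub>o B \<in> Ob C"
  "\<lbrakk>A \<in> Ob C; B \<in> Ob C; D \<in> Ob C\<rbrakk> \<Longrightarrow> (A \<otimes>\<^sub>o B) \<otimes>\<^sub>o D = A \<otimes>\<^sub>o (B \<otimes>\<^sub>o D)"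
  "A \<in> Ob C \<Longrightarrow> \<K> \<otimes>\<^sub>o A = A"
  "A \<in> Ob C \<Longrightarrow> A \<otimes>\<^sub>o \<K> = A"
  by (fact unit_ob tens_ob tens_ob_assoc tens_ob_unit_left tens_ob_unit_right)+

lemma tens_type [simp]:
  assumes "f \<in> Arr C" "g \<in> Arr C"
  shows "f \<otimes> g \<in> Arr C" "src C (f \<otimes> g) = src C f \<otimes>\<^sub>o src C g"
    "trg C (f \<otimes> g) = trg C f \<otimes>\<^sub>o trg C g"
  using tens_hom[of f "src C f" "trg C f" g "src C g" "trg C g"] assms by auto

lemma tens_rules [simp]:
  "\<lbrakk>A \<in> Ob C; B \<in> Ob C\<rbrakk> \<Longrightarrow> \<one> A \<otimes> \<one> B = \<one> (A \<otimes>\<^sub>o B)"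
  "\<lbrakk>f \<in> Arr C; g \<in> Arr C; h \<in> Arr C\<rbrakk> \<Longrightarrow> (f \<otimes> g) \<otimes> h = f \<otimes> (g \<otimes> h)"
  "f \<in> Arr C \<Longrightarrow> \<one> \<K> \<otimes> f = f"
  "f \<in> Arr C \<Longrightarrow> f \<otimes> \<one> \<K> = f"
  by (fact tens_ident tens_assoc tens_unit_left tens_unit_right)+

text \<open>This orientation pushes composition inside tensors, so normal forms are tensors of
  right-nested composites.\<close>

lemma tens_interchange [simp]:
  assumes "f \<in> Arr C" "g \<in> Arr C" "f' \<in> Arr C" "g' \<in> Arr C" "trg C f = src C g" "trg C f' = src C g'"
  shows "(f \<otimes> f') \<Zcomp> (g \<otimes> g') = (f \<Zcomp> g) \<otimes> (f' \<Zcomp> g')"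
  using tens_cmp[of f _ _ g _ f' _ _ g'] assms by auto

lemmas tens_interchange_tail [simp] = tens_interchange[THEN cmp_tail]

text \<open>By strictness \<open>f\<close> equals \<open>\<one> \<K> \<otimes> f\<close>, a form
  that the interchange rule cannot detect; arrows into the unit therefore get their own
  rules.\<close>

lemma tens_counit_cmp:
  assumes "E \<in> Arr C" "trg C E = \<K>" "q \<in> Arr C" "f \<in> Arr C" "trg C q = src C f"
  shows "(E \<otimes> q) \<Zcomp> f = E \<otimes> (q \<Zcomp> f)" "(q \<otimes> E) \<Zcomp> f = (q \<Zcomp> f) \<otimes> E"
  using tens_interchange[of E "\<one> \<K>" q f] tens_interchange[of q f E "\<one> \<K>"] assms by auto

lemma cmp_tens_unit:
  assumes "U \<in> Arr C" "src C U = \<K>" "q \<in> Arr C" "f \<in> Arr C" "trg C f = src C q"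
  shows "f \<Zcomp> (U \<otimes> q) = U \<otimes> (f \<Zcomp> q)" "f \<Zcomp> (q \<otimes> U) = (f \<Zcomp> q) \<otimes> U"
  using tens_interchange[of "\<one> \<K>" U f q] tens_interchange[of f q "\<one> \<K>" U] assms by auto

lemma symm_type [simp]:
  assumes "A \<in> Ob C" "B \<in> Ob C"
  shows "\<sigma> A B \<in> Arr C" "src C (\<sigma> A B) = A \<otimes>\<^sub>o B" "trg C (\<sigma> A B) = B \<otimes>\<^sub>o A"
  using symm_hom[OF assms] by auto

lemma symm_unit_left: "A \<in> Ob C \<Longrightarrow> \<sigma> \<K> A = \<one> A"
  using symm_symm[of A \<K>] symm_unit[of A] cmp_ident(1)[of "\<sigma> \<K> A"] by auto

lemma cmp_symm_tens:
  assumes "f \<in> Arr C" "g \<in> Arr C" "src C f = A" "src C g = B"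
  shows "\<sigma> A B \<Zcomp> (g \<otimes> f) = (f \<otimes> g) \<Zcomp> \<sigma> (trg C f) (trg C g)"
  using symm_natural[of f A _ g B] assms by auto

section \<open>Comultiplications and counits on a tensor product\<close>

definition comul_tens :: "'o \<Rightarrow> 'o \<Rightarrow> 'm \<Rightarrow> 'm \<Rightarrow> 'm" where
  "comul_tens P Q D D' = (D \<otimes> D') \<Zcomp> (\<one> P \<otimes> \<sigma> P Q \<otimes> \<one> Q)"

lemma comul_tens_type [simp]:
  assumes "P \<in> Ob C" "Q \<in> Ob C" "D \<in> hom C P (P \<otimes>\<^sub>o P)" "D' \<in> hom C Q (Q \<otimes>\<^sub>o Q)"
  shows "comul_tens P Q D D' \<in> Arr C" "src C (comul_tens P Q D D') = P \<otimes>\<^sub>o Q"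
    "trg C (comul_tens P Q D D') = P \<otimes>\<^sub>o (Q \<otimes>\<^sub>o (P \<otimes>\<^sub>o Q))"
  using assms by (auto simp: comul_tens_def)

text \<open>Naturality of the middle symmetry. In the counit and pairing laws at least one index of
  the remaining \<open>\<sigma>\<close> is \<open>\<K>\<close>, which makes it an identity.\<close>

lemma comul_tens_cmp:
  assumes [simp]: "P \<in> Ob C" "Q \<in> Ob C" and "D \<in> hom C P (P \<otimes>\<^sub>o P)" "D' \<in> hom C Q (Q \<otimes>\<^sub>o Q)"
    "a \<in> Arr C" "b \<in> Arr C" "a' \<in> Arr C" "b' \<in> Arr C"
    "src C a = P" "src C b = Q" "src C a' = P" "src C b' = Q"
  shows "comul_tens P Q D D' \<Zcomp> ((a \<otimes> b) \<otimes> (a' \<otimes> b'))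
    = ((D \<Zcomp> (a \<otimes> a')) \<otimes> (D' \<Zcomp> (b \<otimes> b'))) 
       \<Zcomp> (\<one> (trg C a) \<otimes> \<sigma> (trg C a') (trg C b) \<otimes> \<one> (trg C b'))"
proof -
  have "(\<one> P \<otimes> \<sigma> P Q \<otimes> \<one> Q) \<Zcomp> (a \<otimes> (b \<otimes> a') \<otimes> b')
     = ((a \<otimes> a') \<otimes> (b \<otimes> b')) \<Zcomp> (\<one> (trg C a) \<otimes> \<sigma> (trg C a') (trg C b) \<otimes> \<one> (trg C b'))"
  proof -
    \<comment> \<open>\<open>tens_rules(2)\<close> is withheld so that the bracket around the two
      middle factors survives for the interchange law.\<close>
    have "(\<one> P \<otimes> (\<sigma> P Q \<otimes> \<one> Q)) \<Zcomp> (a \<otimes> ((b \<otimes> a') \<otimes> b'))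
      = a \<otimes> ((\<sigma> P Q \<Zcomp> (b \<otimes> a')) \<otimes> b')"
      using assms by (simp del: tens_rules(2))
    also have "\<dots> = a \<otimes> (((a' \<otimes> b) \<Zcomp> \<sigma> (trg C a') (trg C b)) \<otimes> b')"
      using assms by (subst cmp_symm_tens) auto
    also have "\<dots> = (a \<otimes> ((a' \<otimes> b) \<otimes> b')) \<Zcomp> (\<one> (trg C a) \<otimes> (\<sigma> (trg C a') (trg C b) \<otimes> \<one> (trg C b')))"
      using assms by (simp del: tens_rules(2))
    finally show ?thesis using assms by simp
  qed
  note * = this
  have "comul_tens P Q D D' \<Zcomp> ((a \<otimes> b) \<otimes> (a' \<otimes> b'))
     = (D \<otimes> D') \<Zcomp> ((\<one> P \<otimes> \<sigma> P Q \<otimes> \<one> Q) \<Zcomp> (a \<otimes> (b \<otimes> a') \<otimes> b'))"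
    using assms unfolding comul_tens_def by simp
  also have "\<dots> = ((D \<otimes> D') \<Zcomp> ((a \<otimes> a') \<otimes> (b \<otimes> b')))
     \<Zcomp> (\<one> (trg C a) \<otimes> \<sigma> (trg C a') (trg C b) \<otimes> \<one> (trg C b'))"
    unfolding * using assms by (simp del: tens_rules(2) tens_interchange tens_interchange_tail)
  also have "\<dots> = ((D \<Zcomp> (a \<otimes> a')) \<otimes> (D' \<Zcomp> (b \<otimes> b'))) 
       \<Zcomp> (\<one> (trg C a) \<otimes> \<sigma> (trg C a') (trg C b) \<otimes> \<one> (trg C b'))"
    using assms by (simp del: tens_rules(2))
  finally show ?thesis .
qed

definition counital_comagma :: "'o \<Rightarrow> 'm \<Rightarrow> 'm \<Rightarrow> bool" where
  "counital_comagma P D E \<longleftrightarrow> P \<in> Ob C \<and> D \<in> hom C P (P \<otimes>\<^sub>o P) \<and> E \<in> hom C P \<K>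
    \<and> D \<Zcomp> (E \<otimes> \<one> P) = \<one> P \<and> D \<Zcomp> (\<one> P \<otimes> E) = \<one> P"

lemma counital_comagma_type:
  assumes "counital_comagma P D E"
  shows "P \<in> Ob C" "D \<in> Arr C" "src C D = P" "trg C D = P \<otimes>\<^sub>o P"
    "E \<in> Arr C" "src C E = P" "trg C E = \<K>"
  using assms by (auto simp: counital_comagma_def)

lemma counital_comagma_cmp:
  assumes c: "counital_comagma P D E" and f: "f \<in> Arr C" "src C f = P"
  shows "D \<Zcomp> (E \<otimes> f) = f" "D \<Zcomp> (f \<otimes> E) = f"
proof -
  note [simp] = counital_comagma_type[OF c] f
  have "D \<Zcomp> (E \<otimes> f) = (D \<Zcomp> (E \<otimes> \<one> P)) \<Zcomp> f"
    by (simp add: tens_counit_cmp)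
  also have "\<dots> = f"
    using c f unfolding counital_comagma_def by (metis cmp_ident(1))
  finally show "D \<Zcomp> (E \<otimes> f) = f" .
  have "D \<Zcomp> (f \<otimes> E) = (D \<Zcomp> (\<one> P \<otimes> E)) \<Zcomp> f"
    by (simp add: tens_counit_cmp)
  also have "\<dots> = f"
    using c f unfolding counital_comagma_def by (metis cmp_ident(1))
  finally show "D \<Zcomp> (f \<otimes> E) = f" .
qed

text \<open>\<open>f \<otimes> E'\<close> and \<open>E \<otimes> g\<close> are \<open>f\<close> and
  \<open>g\<close> preceded by the two projections; the counit laws cancel the discarded
  copies.\<close>

lemma comul_tens_pair:
  assumes c: "counital_comagma P D E" "counital_comagma Q D' E'"
    and f: "f \<in> Arr C" "src C f = P" and g: "g \<in> Arr C" "src C g = Q"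
  shows "comul_tens P Q D D' \<Zcomp> ((f \<otimes> E') \<otimes> (E \<otimes> g)) = f \<otimes> g"
  using assms by (subst comul_tens_cmp)
    (auto simp: counital_comagma_type[OF c(1)] counital_comagma_type[OF c(2)]
       counital_comagma_cmp[OF c(1)] counital_comagma_cmp[OF c(2)] symm_unit)

text \<open>Both arrows discard \<open>Q\<close>, and a counit law merges the two discarded copies
  into one \<open>E'\<close>.\<close>

lemma comul_tens_left:
  assumes c: "counital_comagma P D E" "counital_comagma Q D' E'"
    and f: "f \<in> Arr C" "src C f = P" and g: "g \<in> Arr C" "src C g = P"
  shows "comul_tens P Q D D' \<Zcomp> ((f \<otimes> E') \<otimes> (g \<otimes> E')) = (D \<Zcomp> (f \<otimes> g)) \<otimes> E'"
  using assms by (subst comul_tens_cmp)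
    (auto simp: counital_comagma_type[OF c(1)] counital_comagma_type[OF c(2)]
       counital_comagma_cmp[OF c(1)] counital_comagma_cmp[OF c(2)] symm_unit)

lemma counital_comagma_tens:
  assumes c: "counital_comagma P D E" "counital_comagma Q D' E'"
  shows "counital_comagma (P \<otimes>\<^sub>o Q) (comul_tens P Q D D') (E \<otimes> E')"
proof -
  note [simp] = counital_comagma_type[OF c(1)] counital_comagma_type[OF c(2)]
  \<comment> \<open>Identities stay split as \<open>\<one> P \<otimes> \<one> Q\<close> to match
    \<open>comul_tens_cmp\<close>.\<close>
  have "comul_tens P Q D D' \<Zcomp> ((\<one> P \<otimes> \<one> Q) \<otimes> (E \<otimes> E')) = \<one> P \<otimes> \<one> Q"
    by (subst comul_tens_cmp)
      (auto simp del: tens_rules(1) simp: symm_unit_left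
        counital_comagma_cmp[OF c(1)] counital_comagma_cmp[OF c(2)])
  moreover have "comul_tens P Q D D' \<Zcomp> ((E \<otimes> E') \<otimes> (\<one> P \<otimes> \<one> Q)) = \<one> P \<otimes> \<one> Q"
    by (subst comul_tens_cmp)
      (auto simp del: tens_rules(1) simp: symm_unit
        counital_comagma_cmp[OF c(1)] counital_comagma_cmp[OF c(2)])
  ultimately show ?thesis
    by (simp add: counital_comagma_def)
qed

lemma comul_tens_natural:
  assumes "P \<in> Ob C" "Q \<in> Ob C" "D \<in> hom C P (P \<otimes>\<^sub>o P)" "D' \<in> hom C Q (Q \<otimes>\<^sub>o Q)"
    and h: "h \<in> hom C P R" "h \<Zcomp> G = D \<Zcomp> (h \<otimes> h)"
    and k: "k \<in> hom C Q S" "k \<Zcomp> G' = D' \<Zcomp> (k \<otimes> k)"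
    and G: "G \<in> hom C R (R \<otimes>\<^sub>o R)" "G' \<in> hom C S (S \<otimes>\<^sub>o S)"
  shows "(h \<otimes> k) \<Zcomp> comul_tens R S G G' = comul_tens P Q D D' \<Zcomp> ((h \<otimes> k) \<otimes> (h \<otimes> k))"
proof -
  have [simp]: "R \<in> Ob C" "S \<in> Ob C"
    using h k by auto
  have "(h \<otimes> k) \<Zcomp> comul_tens R S G G'
    = ((h \<Zcomp> G) \<otimes> (k \<Zcomp> G')) \<Zcomp> (\<one> R \<otimes> \<sigma> R S \<otimes> \<one> S)"
    unfolding comul_tens_def using assms(1-5,7) G by simp
  also have "\<dots> = comul_tens P Q D D' \<Zcomp> ((h \<otimes> k) \<otimes> (h \<otimes> k))"
    using assms by (subst comul_tens_cmp) auto
  finally show ?thesis .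
qed

end

section \<open>Naturality, comultiplication and multiplication for the modality\<close>

context bialgebra_modality
begin

lemma bang_ob_rule [simp]: "A \<in> Ob C \<Longrightarrow> bang\<^sub>o A \<in> Ob C"
  by (fact bang_ob)

lemma bang_type [simp]:
  assumes "f \<in> Arr C"
  shows "bang f \<in> Arr C" "src C (bang f) = bang\<^sub>o (src C f)" "trg C (bang f) = bang\<^sub>o (trg C f)"
  using bang_hom[of f "src C f" "trg C f"] assms by auto

lemma bang_rules [simp]:
  "A \<in> Ob C \<Longrightarrow> bang (\<one> A) = \<one> (bang\<^sub>o A)"
  "\<lbrakk>f \<in> Arr C; g \<in> Arr C; trg C f = src C g\<rbrakk> \<Longrightarrow> bang f \<Zcomp> bang g = bang (f \<Zcomp> g)"
  using bang_ident bang_cmp[of f "src C f" "trg C f" g "trg C g"] by auto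

lemmas bang_cmp_tail [simp] = bang_rules(2)[THEN cmp_tail]

lemma component_type [simp]:
  assumes "A \<in> Ob C"
  shows "\<delta> A \<in> Arr C" "src C (\<delta> A) = bang\<^sub>o A" "trg C (\<delta> A) = bang\<^sub>o (bang\<^sub>o A)"
    "\<epsilon> A \<in> Arr C" "src C (\<epsilon> A) = bang\<^sub>o A" "trg C (\<epsilon> A) = A"
    "\<Delta> A \<in> Arr C" "src C (\<Delta> A) = bang\<^sub>o A" "trg C (\<Delta> A) = bang\<^sub>o A \<otimes>\<^sub>o bang\<^sub>o A"
    "e A \<in> Arr C" "src C (e A) = bang\<^sub>o A" "trg C (e A) = \<K>"
    "\<nabla> A \<in> Arr C" "src C (\<nabla> A) = bang\<^sub>o A \<otimes>\<^sub>o bang\<^sub>o A" "trg C (\<nabla> A) = bang\<^sub>o A"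
    "u A \<in> Arr C" "src C (u A) = \<K>" "trg C (u A) = bang\<^sub>o A"
  using \<delta>_hom[OF assms] \<epsilon>_hom[OF assms] \<Delta>_hom[OF assms] e_hom[OF assms]
    nabla_hom[OF assms] u_hom[OF assms] by auto

lemma add_type [simp]:
  assumes "f \<in> Arr C" "g \<in> Arr C" "src C f = src C g" "trg C f = trg C g"
  shows "f \<oplus> g \<in> Arr C" "src C (f \<oplus> g) = src C f" "trg C (f \<oplus> g) = trg C f"
  using add_hom[of f "src C f" "trg C f" g] assms by auto

lemma zero_type [simp]:
  assumes "A \<in> Ob C" "B \<in> Ob C"
  shows "\<zero> A B \<in> Arr C" "src C (\<zero> A B) = A" "trg C (\<zero> A B) = B"
  using zero_hom[OF assms] by auto

text \<open>Every law moves \<open>bang f\<close> to the right of a structure map, or absorbs it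
  into \<open>e\<close>.\<close>

lemma bang_naturality:
  assumes "f \<in> Arr C" "trg C f = B"
  shows "bang f \<Zcomp> \<delta> B = \<delta> (src C f) \<Zcomp> bang (bang f)"
    "bang f \<Zcomp> \<epsilon> B = \<epsilon> (src C f) \<Zcomp> f"
    "bang f \<Zcomp> \<Delta> B = \<Delta> (src C f) \<Zcomp> (bang f \<otimes> bang f)"
    "bang f \<Zcomp> e B = e (src C f)"
    "(bang f \<otimes> bang f) \<Zcomp> \<nabla> B = \<nabla> (src C f) \<Zcomp> bang f"
  using assms by (auto intro: \<delta>_natural \<epsilon>_natural \<Delta>_natural e_natural nabla_natural)

lemma unit_bang: "\<lbrakk>f \<in> Arr C; src C f = A\<rbrakk> \<Longrightarrow> u A \<Zcomp> bang f = u (trg C f)"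
  by (auto intro: u_natural)

lemmas bang_naturality_tail = bang_naturality[THEN cmp_tail] unit_bang[THEN cmp_tail]

text \<open>Replace \<open>e (bang\<^sub>o A)\<close> by
  \<open>bang (\<epsilon> A) \<Zcomp> e A\<close> and cancel
  \<open>\<delta> A \<Zcomp> bang (\<epsilon> A)\<close>.\<close>

lemma \<delta>_e: "A \<in> Ob C \<Longrightarrow> \<delta> A \<Zcomp> e (bang\<^sub>o A) = e A"
  using bang_naturality(4)[of "\<epsilon> A" A] cmp_tail[OF \<delta>_bang_\<epsilon>, of A "e A"] by simp

lemma counital_comagma_bang: "A \<in> Ob C \<Longrightarrow> counital_comagma (bang\<^sub>o A) (\<Delta> A) (e A)"
  by (simp add: counital_comagma_def \<Delta>_counit_left \<Delta>_counit_right)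

text \<open>A leg \<open>E \<Zcomp> u A\<close> contributes only the unit of
  \<open>\<nabla>\<close>, so just its discarding map \<open>E\<close> remains. Legs produced by
  zero maps have this form.\<close>

lemma nabla_unit_cmp:
  assumes "A \<in> Ob C" "p \<in> Arr C" "trg C p = bang\<^sub>o A" "E \<in> Arr C" "trg C E = \<K>"
  shows "(p \<otimes> (E \<Zcomp> u A)) \<Zcomp> \<nabla> A = p \<otimes> E" "((E \<Zcomp> u A) \<otimes> p) \<Zcomp> \<nabla> A = E \<otimes> p"
proof -
  have "(p \<otimes> (E \<Zcomp> u A)) \<Zcomp> \<nabla> A = (p \<otimes> E) \<Zcomp> ((\<one> (bang\<^sub>o A) \<otimes> u A) \<Zcomp> \<nabla> A)"
    using assms tens_interchange_tail[of p "\<one> (bang\<^sub>o A)" E "u A" "\<nabla> A"] by simp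
  then show "(p \<otimes> (E \<Zcomp> u A)) \<Zcomp> \<nabla> A = p \<otimes> E"
    using assms by (simp add: nabla_unit_right)
  have "((E \<Zcomp> u A) \<otimes> p) \<Zcomp> \<nabla> A = (E \<otimes> p) \<Zcomp> ((u A \<otimes> \<one> (bang\<^sub>o A)) \<Zcomp> \<nabla> A)"
    using assms tens_interchange_tail[of E "u A" p "\<one> (bang\<^sub>o A)" "\<nabla> A"] by simp
  then show "((E \<Zcomp> u A) \<otimes> p) \<Zcomp> \<nabla> A = E \<otimes> p"
    using assms by (simp add: nabla_unit_left)
qed

text \<open>Naturality of \<open>\<nabla>\<close> in the direction that pushes a trailing
  \<open>bang f\<close> into both legs.\<close>

lemma nabla_bang:
  assumes "p \<in> hom C P (bang\<^sub>o Y)" "q \<in> hom C Q (bang\<^sub>o Y)" "f \<in> Arr C" "src C f = Y" "Y \<in> Ob C"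
  shows "(p \<otimes> q) \<Zcomp> (\<nabla> Y \<Zcomp> bang f) = ((p \<Zcomp> bang f) \<otimes> (q \<Zcomp> bang f)) \<Zcomp> \<nabla> (trg C f)"
  using assms bang_naturality(5)[of f "trg C f", symmetric] by simp

lemma comul_pair:
  assumes "c \<in> hom C Z (bang\<^sub>o Y)" "c \<Zcomp> \<Delta> Y = D \<Zcomp> (c \<otimes> c)" "D \<in> hom C Z (Z \<otimes>\<^sub>o Z)"
    and "f \<in> hom C (bang\<^sub>o Y) V" "g \<in> hom C (bang\<^sub>o Y) W" "Y \<in> Ob C"
  shows "c \<Zcomp> (\<Delta> Y \<Zcomp> (f \<otimes> g)) = D \<Zcomp> ((c \<Zcomp> f) \<otimes> (c \<Zcomp> g))"
  using assms cmp_tail[OF assms(2), of "f \<otimes> g"] by simp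

text \<open>\<open>\<delta>\<close> preserves comultiplication by \<open>\<delta>_\<Delta>\<close>,
  and \<open>bang F\<close> does so by naturality.\<close>

lemma \<delta>_bang_comul:
  assumes "F \<in> hom C (bang\<^sub>o A) Y" "A \<in> Ob C"
  shows "(\<delta> A \<Zcomp> bang F) \<Zcomp> \<Delta> Y = \<Delta> A \<Zcomp> ((\<delta> A \<Zcomp> bang F) \<otimes> (\<delta> A \<Zcomp> bang F))"
proof -
  have "Y \<in> Ob C" using assms by auto
  then show ?thesis
    using assms \<delta>_\<Delta>[THEN cmp_tail, of A "bang F \<otimes> bang F"] by (simp add: bang_naturality)
qed

text \<open>The bialgebra law says that \<open>\<nabla> Y\<close> preserves the tensor
  comultiplication, and \<open>p \<otimes> q\<close> preserves it by
  \<open>comul_tens_natural\<close>.\<close>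

lemma nabla_comul:
  assumes p: "p \<in> hom C P (bang\<^sub>o Y)" "p \<Zcomp> \<Delta> Y = D \<Zcomp> (p \<otimes> p)" "D \<in> hom C P (P \<otimes>\<^sub>o P)"
    and q: "q \<in> hom C Q (bang\<^sub>o Y)" "q \<Zcomp> \<Delta> Y = D' \<Zcomp> (q \<otimes> q)" "D' \<in> hom C Q (Q \<otimes>\<^sub>o Q)"
    and Y: "Y \<in> Ob C"
  shows "((p \<otimes> q) \<Zcomp> \<nabla> Y) \<Zcomp> \<Delta> Y
    = comul_tens P Q D D' \<Zcomp> (((p \<otimes> q) \<Zcomp> \<nabla> Y) \<otimes> ((p \<otimes> q) \<Zcomp> \<nabla> Y))"
proof -
  have [simp]: "P \<in> Ob C" "Q \<in> Ob C" using p q by auto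
  have "((p \<otimes> q) \<Zcomp> \<nabla> Y) \<Zcomp> \<Delta> Y
    = ((p \<otimes> q) \<Zcomp> comul_tens (bang\<^sub>o Y) (bang\<^sub>o Y) (\<Delta> Y) (\<Delta> Y)) \<Zcomp> (\<nabla> Y \<otimes> \<nabla> Y)"
    using p(1) q(1) Y nabla_\<Delta>[of Y] by (simp add: comul_tens_def)
  also have "\<dots> = (comul_tens P Q D D' \<Zcomp> ((p \<otimes> q) \<otimes> (p \<otimes> q))) \<Zcomp> (\<nabla> Y \<otimes> \<nabla> Y)"
    by (subst comul_tens_natural[of P Q D D' p "bang\<^sub>o Y" "\<Delta> Y" q "bang\<^sub>o Y" "\<Delta> Y"])
      (use p q Y in auto)
  also have "\<dots> = comul_tens P Q D D' \<Zcomp> (((p \<otimes> q) \<otimes> (p \<otimes> q)) \<Zcomp> (\<nabla> Y \<otimes> \<nabla> Y))"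
    using p q Y by (subst cmp_assoc_right) auto
  also have "((p \<otimes> q) \<otimes> (p \<otimes> q)) \<Zcomp> (\<nabla> Y \<otimes> \<nabla> Y) = ((p \<otimes> q) \<Zcomp> \<nabla> Y) \<otimes> ((p \<otimes> q) \<Zcomp> \<nabla> Y)"
    using p q Y by (subst tens_interchange) auto
  finally show ?thesis .
qed

end

section \<open>Zero maps, and sums as convolution products\<close>

context additive_bialgebra_modality
begin

text \<open>Naturality of \<open>u\<close> allows a zero endomorphism to be inserted under
  \<open>bang\<close>; naturality of \<open>\<epsilon>\<close> carries it to the end.\<close>

lemma u_\<epsilon>: "A \<in> Ob C \<Longrightarrow> u A \<Zcomp> \<epsilon> A = \<zero> \<K> A"
proof -
  assume [simp]: "A \<in> Ob C"
  have "u A \<Zcomp> \<epsilon> A = (u A \<Zcomp> bang (\<zero> A A)) \<Zcomp> \<epsilon> A"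
    by (simp add: unit_bang)
  also have "\<dots> = (u A \<Zcomp> \<epsilon> A) \<Zcomp> \<zero> A A"
    by (simp add: bang_naturality)
  also have "\<dots> = \<zero> \<K> A"
    by (rule cmp_zero_right) auto
  finally show ?thesis .
qed

lemma \<delta>_bang_zero:
  assumes "A \<in> Ob C" "B \<in> Ob C"
  shows "\<delta> A \<Zcomp> bang (\<zero> (bang\<^sub>o A) B) = e A \<Zcomp> u B"
  using assms \<delta>_e[THEN cmp_tail, of A "u B"] by (simp add: bang_zero)

text \<open>The additivity law transported along a comultiplication-preserving \<open>c\<close>: a
  sum becomes a convolution product over \<open>D\<close>.\<close>

lemma bang_add_comul:
  assumes c: "c \<in> hom C Z (bang\<^sub>o Y)" "c \<Zcomp> \<Delta> Y = D \<Zcomp> (c \<otimes> c)" "D \<in> hom C Z (Z \<otimes>\<^sub>o Z)"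
    and fg: "f \<in> hom C Y W" "g \<in> hom C Y W" and Y: "Y \<in> Ob C"
  shows "c \<Zcomp> bang (f \<oplus> g) = D \<Zcomp> (((c \<Zcomp> bang f) \<otimes> (c \<Zcomp> bang g)) \<Zcomp> \<nabla> W)"
proof -
  have "c \<Zcomp> bang (f \<oplus> g) = (c \<Zcomp> (\<Delta> Y \<Zcomp> (bang f \<otimes> bang g))) \<Zcomp> \<nabla> W"
    using assms bang_add[OF fg] by auto
  also have "\<dots> = (D \<Zcomp> ((c \<Zcomp> bang f) \<otimes> (c \<Zcomp> bang g))) \<Zcomp> \<nabla> W"
    using assms by (subst comul_pair[OF c]) auto
  finally show ?thesis
    using assms by auto
qed

text \<open>Each convolution factor lives on one tensor factor, so \<open>comul_tens_pair\<close>
  removes the comultiplication.\<close>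

lemma bang_add_comul_tens:
  assumes c: "c \<in> hom C (P \<otimes>\<^sub>o Q) (bang\<^sub>o Y)" "c \<Zcomp> \<Delta> Y = comul_tens P Q D D' \<Zcomp> (c \<otimes> c)"
    and PQ: "counital_comagma P D E" "counital_comagma Q D' E'"
    and f: "f \<in> hom C Y W" "c \<Zcomp> bang f = p \<otimes> E'" and p: "p \<in> hom C P (bang\<^sub>o W)"
    and g: "g \<in> hom C Y W" "c \<Zcomp> bang g = E \<otimes> q" and q: "q \<in> hom C Q (bang\<^sub>o W)"
    and Y: "Y \<in> Ob C"
  shows "c \<Zcomp> bang (f \<oplus> g) = (p \<otimes> q) \<Zcomp> \<nabla> W"
proof -
  note [simp] = counital_comagma_type[OF PQ(1)] counital_comagma_type[OF PQ(2)]
  have [simp]: "W \<in> Ob C" using f by auto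
  have "c \<Zcomp> bang (f \<oplus> g) = comul_tens P Q D D' \<Zcomp> (((p \<otimes> E') \<otimes> (E \<otimes> q)) \<Zcomp> \<nabla> W)"
    using bang_add_comul[OF c, of f W g] f g Y by simp
  also have "\<dots> = (comul_tens P Q D D' \<Zcomp> ((p \<otimes> E') \<otimes> (E \<otimes> q))) \<Zcomp> \<nabla> W"
    using p q by simp
  also have "\<dots> = (p \<otimes> q) \<Zcomp> \<nabla> W"
    using p q comul_tens_pair[OF PQ, of p q] by (simp del: tens_rules(2))
  finally show ?thesis .
qed

text \<open>
  A coalgebra morphism into an object whose coalgebra structure \<open>i \<Zcomp> \<delta> Y \<Zcomp> bang r\<close> comes from a
  retract \<open>i\<close>, \<open>r\<close> of a cofree coalgebra is recognised after composition with \<open>i\<close>.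
\<close>

lemma coalgebra_mor_retract:
  assumes c: "c \<in> hom C Z (bang\<^sub>o Z)" "c \<Zcomp> \<delta> Z = c \<Zcomp> bang c" and h: "h \<in> hom C Z Z'"
    and i: "i \<in> hom C Z' (bang\<^sub>o Y)" and r: "r \<in> hom C (bang\<^sub>o Y) Z'" and ir: "i \<Zcomp> r = \<one> Z'"
    and t: "t \<in> hom C Z Y" "h \<Zcomp> i = c \<Zcomp> bang t"
  shows "h \<Zcomp> (i \<Zcomp> (\<delta> Y \<Zcomp> bang r)) = c \<Zcomp> bang h"
proof -
  have [simp]: "Y \<in> Ob C" "Z \<in> Ob C" "Z' \<in> Ob C" using t h by auto
  have "h \<Zcomp> (i \<Zcomp> (\<delta> Y \<Zcomp> bang r)) = (c \<Zcomp> bang t) \<Zcomp> (\<delta> Y \<Zcomp> bang r)"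
    using assms by (simp flip: t(2))
  also have "\<dots> = (c \<Zcomp> \<delta> Z) \<Zcomp> bang (bang t \<Zcomp> r)"
    using c(1) r t(1) by (simp add: bang_naturality bang_naturality_tail)
  also have "\<dots> = c \<Zcomp> bang ((c \<Zcomp> bang t) \<Zcomp> r)"
    unfolding c(2) using c(1) r t(1) by simp
  also have "(c \<Zcomp> bang t) \<Zcomp> r = h"
    using h i r ir by (simp flip: t(2))
  finally show ?thesis .
qed

section \<open>The retraction of the cofree coalgebra and the induced structure\<close>

definition seely_in :: "'o \<Rightarrow> 'o \<Rightarrow> 'm" where
  "seely_in A B = ((\<delta> A \<Zcomp> bang (\<one> (bang\<^sub>o A) \<otimes> u B)) \<otimes> (\<delta> B \<Zcomp> bang (u A \<otimes> \<one> (bang\<^sub>o B))))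
    \<Zcomp> \<nabla> (bang\<^sub>o A \<otimes>\<^sub>o bang\<^sub>o B)"

text \<open>\<open>\<epsilon> \<otimes> e\<close> and \<open>e \<otimes> \<epsilon>\<close> stand in
  for biproduct projections, as \<open>\<one> \<otimes> u\<close> and
  \<open>u \<otimes> \<one>\<close> in \<open>seely_in\<close> stand in for injections.\<close>

definition seely_out :: "'o \<Rightarrow> 'o \<Rightarrow> 'm" where
  "seely_out A B = \<Delta> (bang\<^sub>o A \<otimes>\<^sub>o bang\<^sub>o B) \<Zcomp> (bang (\<epsilon> A \<otimes> e B) \<otimes> bang (e A \<otimes> \<epsilon> B))"

definition seely_coalg :: "'o \<Rightarrow> 'o \<Rightarrow> 'm" where
  "seely_coalg A B = seely_in A B \<Zcomp> (\<delta> (bang\<^sub>o A \<otimes>\<^sub>o bang\<^sub>o B) \<Zcomp> bang (seely_out A B))"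

abbreviation seely_comul :: "'o \<Rightarrow> 'o \<Rightarrow> 'm" where
  "seely_comul A B \<equiv> comul_tens (bang\<^sub>o A) (bang\<^sub>o B) (\<Delta> A) (\<Delta> B)"

context
  fixes A B
  assumes AB [simp]: "A \<in> Ob C" "B \<in> Ob C"
begin

lemma seely_type [simp]:
  "seely_in A B \<in> Arr C" "src C (seely_in A B) = bang\<^sub>o A \<otimes>\<^sub>o bang\<^sub>o B"
  "trg C (seely_in A B) = bang\<^sub>o (bang\<^sub>o A \<otimes>\<^sub>o bang\<^sub>o B)"
  "seely_out A B \<in> Arr C" "src C (seely_out A B) = bang\<^sub>o (bang\<^sub>o A \<otimes>\<^sub>o bang\<^sub>o B)"
  "trg C (seely_out A B) = bang\<^sub>o A \<otimes>\<^sub>o bang\<^sub>o B"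
  "seely_coalg A B \<in> Arr C" "src C (seely_coalg A B) = bang\<^sub>o A \<otimes>\<^sub>o bang\<^sub>o B"
  "trg C (seely_coalg A B) = bang\<^sub>o (bang\<^sub>o A \<otimes>\<^sub>o bang\<^sub>o B)"
  by (simp_all add: seely_in_def seely_out_def seely_coalg_def)

lemma seely_in_bang:
  assumes "f \<in> hom C (bang\<^sub>o A \<otimes>\<^sub>o bang\<^sub>o B) W"
  shows "seely_in A B \<Zcomp> bang f
    = ((\<delta> A \<Zcomp> bang ((\<one> (bang\<^sub>o A) \<otimes> u B) \<Zcomp> f)) \<otimes> (\<delta> B \<Zcomp> bang ((u A \<otimes> \<one> (bang\<^sub>o B)) \<Zcomp> f))) \<Zcomp> \<nabla> W"
  using assms unfolding seely_in_def by (auto simp: nabla_bang)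

text \<open>Injections followed by projections form a diagonal matrix: \<open>u \<Zcomp> e\<close>
  is an identity, which leaves \<open>\<epsilon>\<close> on the diagonal, and
  \<open>u \<Zcomp> \<epsilon>\<close> is zero. The diagonal legs become identities by
  \<open>\<delta>_bang_\<epsilon>\<close>; the others become \<open>e \<Zcomp> u\<close> and are
  absorbed by \<open>\<nabla>\<close>.\<close>

lemma seely_in_proj:
  "seely_in A B \<Zcomp> bang (\<epsilon> A \<otimes> e B) = \<one> (bang\<^sub>o A) \<otimes> e B"
  "seely_in A B \<Zcomp> bang (e A \<otimes> \<epsilon> B) = e A \<otimes> \<one> (bang\<^sub>o B)"
proof -
  have 1: "(\<one> (bang\<^sub>o A) \<otimes> u B) \<Zcomp> (\<epsilon> A \<otimes> e B) = \<epsilon> A" "(u A \<otimes> \<one> (bang\<^sub>o B)) \<Zcomp> (e A \<otimes> \<epsilon> B) = \<epsilon> B"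
    by (simp_all add: u_e)
  have "(u A \<otimes> \<one> (bang\<^sub>o B)) \<Zcomp> (\<epsilon> A \<otimes> e B) = \<zero> \<K> A \<otimes> e B"
    by (simp add: u_\<epsilon>)
  also have "\<dots> = \<zero> (bang\<^sub>o B) A"
    using tens_zero_left[of \<K> A "e B" "bang\<^sub>o B" \<K>] by simp
  finally have 2: "(u A \<otimes> \<one> (bang\<^sub>o B)) \<Zcomp> (\<epsilon> A \<otimes> e B) = \<zero> (bang\<^sub>o B) A" .
  have "(\<one> (bang\<^sub>o A) \<otimes> u B) \<Zcomp> (e A \<otimes> \<epsilon> B) = e A \<otimes> \<zero> \<K> B"
    by (simp add: u_\<epsilon>)
  also have "\<dots> = \<zero> (bang\<^sub>o A) B"
    using tens_zero_right[of "e A" "bang\<^sub>o A" \<K> \<K> B] by simp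
  finally have 3: "(\<one> (bang\<^sub>o A) \<otimes> u B) \<Zcomp> (e A \<otimes> \<epsilon> B) = \<zero> (bang\<^sub>o A) B" .
  show "seely_in A B \<Zcomp> bang (\<epsilon> A \<otimes> e B) = \<one> (bang\<^sub>o A) \<otimes> e B"
    \<comment> \<open>The matrix entries are rewritten first, since full normalisation would break
      up their left-hand sides.\<close>
    by (subst seely_in_bang[of _ A])
      (auto simp only: 1 2, auto simp: \<delta>_bang_zero nabla_unit_cmp \<delta>_bang_\<epsilon>)
  show "seely_in A B \<Zcomp> bang (e A \<otimes> \<epsilon> B) = e A \<otimes> \<one> (bang\<^sub>o B)"
    by (subst seely_in_bang[of _ B])
      (auto simp only: 1 3, auto simp: \<delta>_bang_zero nabla_unit_cmp \<delta>_bang_\<epsilon>)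
qed

lemma seely_in_comul:
  "seely_in A B \<Zcomp> \<Delta> (bang\<^sub>o A \<otimes>\<^sub>o bang\<^sub>o B) = seely_comul A B \<Zcomp> (seely_in A B \<otimes> seely_in A B)"
  unfolding seely_in_def by (rule nabla_comul[OF _ \<delta>_bang_comul _ _ \<delta>_bang_comul]) auto

text \<open>Comultiplication passes through \<open>seely_in\<close>, which turns the two lifted
  projections into \<open>\<one> \<otimes> e\<close> and \<open>e \<otimes> \<one>\<close>; their
  pairing is the identity.\<close>

lemma seely_in_out: "seely_in A B \<Zcomp> seely_out A B = \<one> (bang\<^sub>o A \<otimes>\<^sub>o bang\<^sub>o B)"
proof -
  have "seely_in A B \<Zcomp> seely_out A B
    = seely_comul A B \<Zcomp> ((\<one> (bang\<^sub>o A) \<otimes> e B) \<otimes> (e A \<otimes> \<one> (bang\<^sub>o B)))"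
    unfolding seely_out_def seely_in_proj[symmetric]
    by (rule comul_pair[OF _ seely_in_comul]) auto
  also have "\<dots> = \<one> (bang\<^sub>o A) \<otimes> \<one> (bang\<^sub>o B)"
    by (rule comul_tens_pair) (auto intro: counital_comagma_bang)
  finally show ?thesis by simp
qed

text \<open>Additivity writes the idempotent as \<open>\<delta>\<close> followed by
  \<open>bang\<close> of the sum of the two projection-injection composites. Such a lift is a
  coalgebra endomorphism of the cofree coalgebra.\<close>

lemma seely_out_in:
  "seely_out A B \<Zcomp> seely_in A B = \<delta> (bang\<^sub>o A \<otimes>\<^sub>o bang\<^sub>o B) \<Zcomp>
     bang ((bang (\<epsilon> A \<otimes> e B) \<Zcomp> (\<one> (bang\<^sub>o A) \<otimes> u B)) \<oplus> (bang (e A \<otimes> \<epsilon> B) \<Zcomp> (u A \<otimes> \<one> (bang\<^sub>o B))))"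
  (is "_ = \<delta> ?X \<Zcomp> bang (?f \<oplus> ?g)")
proof -
  have "\<delta> ?X \<Zcomp> bang (?f \<oplus> ?g) = \<Delta> ?X \<Zcomp> (((\<delta> ?X \<Zcomp> bang ?f) \<otimes> (\<delta> ?X \<Zcomp> bang ?g)) \<Zcomp> \<nabla> ?X)"
    by (rule bang_add_comul) (auto simp: \<delta>_\<Delta>)
  also have "\<delta> ?X \<Zcomp> bang ?f = bang (\<epsilon> A \<otimes> e B) \<Zcomp> (\<delta> A \<Zcomp> bang (\<one> (bang\<^sub>o A) \<otimes> u B))"
    by (simp add: bang_naturality_tail)
  also have "\<delta> ?X \<Zcomp> bang ?g = bang (e A \<otimes> \<epsilon> B) \<Zcomp> (\<delta> B \<Zcomp> bang (u A \<otimes> \<one> (bang\<^sub>o B)))"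
    by (simp add: bang_naturality_tail)
  finally show ?thesis
    by (simp add: seely_in_def seely_out_def)
qed

text \<open>\<open>seely_in\<close> is a coalgebra morphism into the cofree coalgebra, because the
  idempotent \<open>seely_out A B \<Zcomp> seely_in A B\<close> commutes with
  \<open>\<delta>\<close> and fixes \<open>seely_in\<close>.\<close>

lemma seely_coalg_bang_in:
  "seely_coalg A B \<Zcomp> bang (seely_in A B) = seely_in A B \<Zcomp> \<delta> (bang\<^sub>o A \<otimes>\<^sub>o bang\<^sub>o B)"
  (is "_ = _ \<Zcomp> \<delta> ?X")
proof -
  define q where "q = (bang (\<epsilon> A \<otimes> e B) \<Zcomp> (\<one> (bang\<^sub>o A) \<otimes> u B)) \<oplus> (bang (e A \<otimes> \<epsilon> B) \<Zcomp> (u A \<otimes> \<one> (bang\<^sub>o B)))"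
  have q [simp]: "q \<in> Arr C" "src C q = bang\<^sub>o ?X" "trg C q = ?X"
    by (simp_all add: q_def)
  have "seely_coalg A B \<Zcomp> bang (seely_in A B) = seely_in A B \<Zcomp> (\<delta> ?X \<Zcomp> bang (\<delta> ?X \<Zcomp> bang q))"
    by (simp add: seely_coalg_def seely_out_in q_def)
  also have "\<dots> = seely_in A B \<Zcomp> ((\<delta> ?X \<Zcomp> bang (\<delta> ?X)) \<Zcomp> bang (bang q))"
    by simp
  also have "\<dots> = (seely_in A B \<Zcomp> (\<delta> ?X \<Zcomp> bang q)) \<Zcomp> \<delta> ?X"
    by (simp add: \<delta>_\<delta>[symmetric] bang_naturality)
  also have "\<delta> ?X \<Zcomp> bang q = seely_out A B \<Zcomp> seely_in A B"
    by (simp add: seely_out_in q_def)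
  also have "seely_in A B \<Zcomp> (seely_out A B \<Zcomp> seely_in A B) = seely_in A B"
    by (simp add: seely_in_out[THEN cmp_tail])
  finally show ?thesis .
qed

text \<open>Since \<open>seely_in\<close> is a coalgebra morphism, coassociativity is inherited from
  \<open>\<delta>_\<delta>\<close>.\<close>

lemma seely_coalg_\<delta>:
  "seely_coalg A B \<Zcomp> \<delta> (bang\<^sub>o A \<otimes>\<^sub>o bang\<^sub>o B) = seely_coalg A B \<Zcomp> bang (seely_coalg A B)"
  (is "_ \<Zcomp> \<delta> ?X = _")
proof -
  have "seely_coalg A B \<Zcomp> bang (seely_coalg A B)
    = (seely_coalg A B \<Zcomp> bang (seely_in A B)) \<Zcomp> bang (\<delta> ?X \<Zcomp> bang (seely_out A B))"
    by (subst (2) seely_coalg_def) simp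
  also have "\<dots> = seely_in A B \<Zcomp> ((\<delta> ?X \<Zcomp> bang (\<delta> ?X)) \<Zcomp> bang (bang (seely_out A B)))"
    by (simp add: seely_coalg_bang_in)
  also have "\<dots> = seely_coalg A B \<Zcomp> \<delta> ?X"
    by (simp add: seely_coalg_def \<delta>_\<delta>[symmetric] bang_naturality)
  finally show ?thesis by simp
qed

lemma seely_coalg_\<epsilon>: "seely_coalg A B \<Zcomp> \<epsilon> (bang\<^sub>o A \<otimes>\<^sub>o bang\<^sub>o B) = \<one> (bang\<^sub>o A \<otimes>\<^sub>o bang\<^sub>o B)"
  by (simp add: seely_coalg_def bang_naturality \<delta>_\<epsilon>[THEN cmp_tail] seely_in_out)

lemma seely_coalg_comul:
  "seely_coalg A B \<Zcomp> \<Delta> (bang\<^sub>o A \<otimes>\<^sub>o bang\<^sub>o B) = seely_comul A B \<Zcomp> (seely_coalg A B \<otimes> seely_coalg A B)"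
  by (simp add: seely_coalg_def bang_naturality \<delta>_\<Delta>[THEN cmp_tail] seely_in_comul[THEN cmp_tail])

lemma seely_coalg_e: "seely_coalg A B \<Zcomp> e (bang\<^sub>o A \<otimes>\<^sub>o bang\<^sub>o B) = e A \<otimes> e B"
  by (simp add: seely_coalg_def seely_in_def bang_naturality \<delta>_e nabla_e)

lemma seely_out_proj:
  "seely_out A B \<Zcomp> (\<one> (bang\<^sub>o A) \<otimes> e B) = bang (\<epsilon> A \<otimes> e B)"
  "seely_out A B \<Zcomp> (e A \<otimes> \<one> (bang\<^sub>o B)) = bang (e A \<otimes> \<epsilon> B)"
  by (simp_all add: seely_out_def bang_naturality counital_comagma_cmp[OF counital_comagma_bang])

text \<open>The projections \<open>\<one> \<otimes> e\<close> and \<open>e \<otimes> \<one>\<close>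
  are coalgebra morphisms: after \<open>seely_out\<close> they are of the form \<open>bang\<close>,
  past which \<open>\<delta>\<close> moves, and \<open>seely_in_proj\<close> evaluates the
  rest.\<close>

lemma seely_coalg_proj:
  "seely_coalg A B \<Zcomp> bang (\<one> (bang\<^sub>o A) \<otimes> e B) = \<delta> A \<otimes> e B"
  "seely_coalg A B \<Zcomp> bang (e A \<otimes> \<one> (bang\<^sub>o B)) = e A \<otimes> \<delta> B"
  using bang_naturality(1)[of "\<epsilon> A \<otimes> e B" A, symmetric] bang_naturality(1)[of "e A \<otimes> \<epsilon> B" B, symmetric]
  by (simp_all add: seely_coalg_def seely_out_proj seely_in_proj[THEN cmp_tail] tens_counit_cmp)

text \<open>This puts an arrow followed by \<open>seely_in\<close> into the form
  \<open>c \<Zcomp> bang t\<close> demanded by \<open>coalgebra_mor_retract\<close>.\<close>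

lemma seely_coalg_bang_add:
  assumes "f \<in> hom C (bang\<^sub>o A) W" "g \<in> hom C (bang\<^sub>o B) W"
  shows "seely_coalg A B \<Zcomp> bang ((f \<otimes> e B) \<oplus> (e A \<otimes> g)) = ((\<delta> A \<Zcomp> bang f) \<otimes> (\<delta> B \<Zcomp> bang g)) \<Zcomp> \<nabla> W"
proof -
  have "seely_coalg A B \<Zcomp> bang (f \<otimes> e B) = (seely_coalg A B \<Zcomp> bang (\<one> (bang\<^sub>o A) \<otimes> e B)) \<Zcomp> bang f"
    using assms by (simp add: tens_counit_cmp)
  then have 1: "seely_coalg A B \<Zcomp> bang (f \<otimes> e B) = (\<delta> A \<Zcomp> bang f) \<otimes> e B"
    using assms by (simp only: seely_coalg_proj) (simp add: tens_counit_cmp)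
  have "seely_coalg A B \<Zcomp> bang (e A \<otimes> g) = (seely_coalg A B \<Zcomp> bang (e A \<otimes> \<one> (bang\<^sub>o B))) \<Zcomp> bang g"
    using assms by (simp add: tens_counit_cmp)
  then have 2: "seely_coalg A B \<Zcomp> bang (e A \<otimes> g) = e A \<otimes> (\<delta> B \<Zcomp> bang g)"
    using assms by (simp only: seely_coalg_proj) (simp add: tens_counit_cmp)
  show ?thesis
    by (rule bang_add_comul_tens[OF _ seely_coalg_comul
        counital_comagma_bang counital_comagma_bang _ 1 _ _ 2]) (use assms in auto)
qed

end

section \<open>Coalgebra morphisms between the induced structures\<close>

lemma seely_coalg_tens_mor:
  assumes [simp]: "A \<in> Ob C" "B \<in> Ob C" "A' \<in> Ob C" "B' \<in> Ob C"
    and h: "h \<in> hom C (bang\<^sub>o A) (bang\<^sub>o A')" "h \<Zcomp> \<delta> A' = \<delta> A \<Zcomp> bang h"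
    and k: "k \<in> hom C (bang\<^sub>o B) (bang\<^sub>o B')" "k \<Zcomp> \<delta> B' = \<delta> B \<Zcomp> bang k"
  shows "(h \<otimes> k) \<Zcomp> seely_coalg A' B' = seely_coalg A B \<Zcomp> bang (h \<otimes> k)"
proof -
  \<comment> \<open>The witness \<open>t\<close> is \<open>h\<close> with the first injection on the
    left factor, plus \<open>k\<close> with the second injection on the right factor.\<close>
  have "(h \<otimes> k) \<Zcomp> seely_in A' B'
    = seely_coalg A B \<Zcomp> bang (((h \<otimes> u B') \<otimes> e B) \<oplus> (e A \<otimes> (u A' \<otimes> k)))"
    using h k
    by (subst seely_coalg_bang_add)
      (auto simp: seely_in_def h(2)[THEN cmp_tail] k(2)[THEN cmp_tail] cmp_tens_unit)
  then show ?thesis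
    unfolding seely_coalg_def[of A' B']
    \<comment> \<open>The rotation brings the equation for \<open>t\<close> to the front, so that
      the chained fact fixes the witness.\<close>
    by (rule coalgebra_mor_retract[OF _ seely_coalg_\<delta> _ _ _ seely_in_out, rotated -1])
      (use h k in auto)
qed

lemma seely_coalg_symm:
  assumes [simp]: "A \<in> Ob C" "B \<in> Ob C"
  shows "\<sigma> (bang\<^sub>o A) (bang\<^sub>o B) \<Zcomp> seely_coalg B A
    = seely_coalg A B \<Zcomp> bang (\<sigma> (bang\<^sub>o A) (bang\<^sub>o B))"
proof -
  \<comment> \<open>The symmetry exchanges the two injections, and commutativity of
    \<open>\<nabla>\<close> restores their order.\<close>
  have "\<sigma> (bang\<^sub>o A) (bang\<^sub>o B) \<Zcomp> seely_in B A
    = seely_coalg A B \<Zcomp> bang (((u B \<otimes> \<one> (bang\<^sub>o A)) \<otimes> e B) \<oplus> (e A \<otimes> (\<one> (bang\<^sub>o B) \<otimes> u A)))"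
    by (subst seely_coalg_bang_add[of A B _ "bang\<^sub>o B \<otimes>\<^sub>o bang\<^sub>o A"])
      (auto simp: seely_in_def cmp_symm_tens[THEN cmp_tail] nabla_commute)
  then show ?thesis
    unfolding seely_coalg_def[of B A]
    by (rule coalgebra_mor_retract[OF _ seely_coalg_\<delta> _ _ _ seely_in_out, rotated -1]) auto
qed

lemma seely_coalg_\<Delta>:
  assumes [simp]: "A \<in> Ob C"
  shows "\<Delta> A \<Zcomp> seely_coalg A A = \<delta> A \<Zcomp> bang (\<Delta> A)"
proof -
  \<comment> \<open>By additivity, duplication corresponds to the sum of the two injections.\<close>
  have "\<Delta> A \<Zcomp> seely_in A A = \<delta> A \<Zcomp> bang ((\<one> (bang\<^sub>o A) \<otimes> u A) \<oplus> (u A \<otimes> \<one> (bang\<^sub>o A)))"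
    by (subst bang_add_comul[OF _ \<delta>_\<Delta>, of _ _ _ "bang\<^sub>o A \<otimes>\<^sub>o bang\<^sub>o A"]) (auto simp: seely_in_def)
  then show ?thesis
    unfolding seely_coalg_def
    by (rule coalgebra_mor_retract[OF _ \<delta>_\<delta> _ _ _ seely_in_out, rotated -1]) auto
qed

section \<open>The monoidal structure maps and their basic laws\<close>

definition mtens :: "'o \<Rightarrow> 'o \<Rightarrow> 'm" where
  "mtens A B = seely_coalg A B \<Zcomp> bang (\<epsilon> A \<otimes> \<epsilon> B)"

definition munit :: "'m" where
  "munit = u \<K> \<Zcomp> (\<delta> \<K> \<Zcomp> bang (e \<K>))"

lemma m_type [simp]:
  "\<lbrakk>A \<in> Ob C; B \<in> Ob C\<rbrakk> \<Longrightarrow> mtens A B \<in> Arr C"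
  "\<lbrakk>A \<in> Ob C; B \<in> Ob C\<rbrakk> \<Longrightarrow> src C (mtens A B) = bang\<^sub>o A \<otimes>\<^sub>o bang\<^sub>o B"
  "\<lbrakk>A \<in> Ob C; B \<in> Ob C\<rbrakk> \<Longrightarrow> trg C (mtens A B) = bang\<^sub>o (A \<otimes>\<^sub>o B)"
  "munit \<in> Arr C" "src C munit = \<K>" "trg C munit = bang\<^sub>o \<K>"
  by (simp_all add: mtens_def munit_def)

lemma mtens_natural:
  assumes "f \<in> hom C A B" "g \<in> hom C A' B'"
  shows "(bang f \<otimes> bang g) \<Zcomp> mtens B B' = mtens A A' \<Zcomp> bang (f \<otimes> g)"
proof -
  have [simp]: "A \<in> Ob C" "B \<in> Ob C" "A' \<in> Ob C" "B' \<in> Ob C"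
    using assms by auto
  have "(bang f \<otimes> bang g) \<Zcomp> seely_coalg B B' = seely_coalg A A' \<Zcomp> bang (bang f \<otimes> bang g)"
    by (rule seely_coalg_tens_mor) (use assms in \<open>auto simp: bang_naturality\<close>)
  then have "(bang f \<otimes> bang g) \<Zcomp> mtens B B'
    = (seely_coalg A A' \<Zcomp> bang (bang f \<otimes> bang g)) \<Zcomp> bang (\<epsilon> B \<otimes> \<epsilon> B')"
    using assms by (simp add: mtens_def cmp_tail)
  also have "\<dots> = mtens A A' \<Zcomp> bang (f \<otimes> g)"
    using assms by (simp add: mtens_def bang_naturality)
  finally show ?thesis .
qed

text \<open>\<open>\<delta>\<close> is a coalgebra morphism, so it slides through
  \<open>seely_coalg\<close> and cancels against \<open>\<epsilon>\<close>. The second equation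
  exhibits \<open>seely_coalg A B\<close> as the tensor of the coalgebras \<open>\<delta> A\<close>
  and \<open>\<delta> B\<close>.\<close>

lemma \<delta>_mtens:
  assumes [simp]: "A \<in> Ob C" "B \<in> Ob C"
  shows "(\<delta> A \<otimes> \<one> (bang\<^sub>o B)) \<Zcomp> mtens (bang\<^sub>o A) B = seely_coalg A B \<Zcomp> bang (\<one> (bang\<^sub>o A) \<otimes> \<epsilon> B)"
    "(\<delta> A \<otimes> \<delta> B) \<Zcomp> mtens (bang\<^sub>o A) (bang\<^sub>o B) = seely_coalg A B"
proof -
  have "(\<delta> A \<otimes> \<one> (bang\<^sub>o B)) \<Zcomp> seely_coalg (bang\<^sub>o A) B = seely_coalg A B \<Zcomp> bang (\<delta> A \<otimes> \<one> (bang\<^sub>o B))"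
    by (rule seely_coalg_tens_mor) (auto simp: \<delta>_\<delta>)
  from this[THEN cmp_tail, of "bang (\<epsilon> (bang\<^sub>o A) \<otimes> \<epsilon> B)"]
  show "(\<delta> A \<otimes> \<one> (bang\<^sub>o B)) \<Zcomp> mtens (bang\<^sub>o A) B = seely_coalg A B \<Zcomp> bang (\<one> (bang\<^sub>o A) \<otimes> \<epsilon> B)"
    by (simp add: mtens_def \<delta>_\<epsilon>)
  have "(\<delta> A \<otimes> \<delta> B) \<Zcomp> seely_coalg (bang\<^sub>o A) (bang\<^sub>o B) = seely_coalg A B \<Zcomp> bang (\<delta> A \<otimes> \<delta> B)"
    by (rule seely_coalg_tens_mor) (auto simp: \<delta>_\<delta>)
  from this[THEN cmp_tail, of "bang (\<epsilon> (bang\<^sub>o A) \<otimes> \<epsilon> (bang\<^sub>o B))"]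
  show "(\<delta> A \<otimes> \<delta> B) \<Zcomp> mtens (bang\<^sub>o A) (bang\<^sub>o B) = seely_coalg A B"
    by (simp add: mtens_def \<delta>_\<epsilon>)
qed

lemma mtens_symm:
  assumes [simp]: "A \<in> Ob C" "B \<in> Ob C"
  shows "mtens A B \<Zcomp> bang (\<sigma> A B) = \<sigma> (bang\<^sub>o A) (bang\<^sub>o B) \<Zcomp> mtens B A"
  by (simp add: mtens_def seely_coalg_symm[THEN cmp_tail] cmp_symm_tens)

text \<open>Naturality moves \<open>bang (e \<K>)\<close> out of the first argument; what remains is
  a projection of \<open>seely_coalg\<close>, whose factor \<open>e \<K>\<close> is cancelled by
  \<open>u \<K>\<close>.\<close>

lemma mtens_unit_left:
  assumes [simp]: "A \<in> Ob C"
  shows "(munit \<otimes> \<one> (bang\<^sub>o A)) \<Zcomp> mtens \<K> A = \<one> (bang\<^sub>o A)"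
proof -
  \<comment> \<open>The identity enters as \<open>bang (\<one> A)\<close>, so that
    \<open>mtens_natural\<close> applies in both arguments.\<close>
  have "(munit \<otimes> \<one> (bang\<^sub>o A)) \<Zcomp> mtens \<K> A
    = (u \<K> \<otimes> \<one> (bang\<^sub>o A)) \<Zcomp> ((\<delta> \<K> \<otimes> \<one> (bang\<^sub>o A)) \<Zcomp> ((bang (e \<K>) \<otimes> bang (\<one> A)) \<Zcomp> mtens \<K> A))"
    by (simp add: munit_def)
  also have "(bang (e \<K>) \<otimes> bang (\<one> A)) \<Zcomp> mtens \<K> A = mtens (bang\<^sub>o \<K>) A \<Zcomp> bang (e \<K> \<otimes> \<one> A)"
    by (rule mtens_natural) auto
  also have "(\<delta> \<K> \<otimes> \<one> (bang\<^sub>o A)) \<Zcomp> (mtens (bang\<^sub>o \<K>) A \<Zcomp> bang (e \<K> \<otimes> \<one> A))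
    = (seely_coalg \<K> A \<Zcomp> bang (e \<K> \<otimes> \<one> (bang\<^sub>o A))) \<Zcomp> bang (\<epsilon> A)"
    by (simp add: \<delta>_mtens[THEN cmp_tail] tens_counit_cmp)
  also have "\<dots> = e \<K> \<otimes> \<one> (bang\<^sub>o A)"
    by (simp only: seely_coalg_proj assms unit_ob) (simp add: tens_counit_cmp \<delta>_bang_\<epsilon>)
  also have "(u \<K> \<otimes> \<one> (bang\<^sub>o A)) \<Zcomp> (e \<K> \<otimes> \<one> (bang\<^sub>o A)) = \<one> (bang\<^sub>o A)"
    by (simp add: u_e)
  finally show ?thesis .
qed

lemma mtens_unit_right:
  assumes [simp]: "A \<in> Ob C"
  shows "(\<one> (bang\<^sub>o A) \<otimes> munit) \<Zcomp> mtens A \<K> = \<one> (bang\<^sub>o A)"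
proof -
  have "mtens A \<K> = \<sigma> (bang\<^sub>o A) (bang\<^sub>o \<K>) \<Zcomp> mtens \<K> A"
    using mtens_symm[of A \<K>] by (simp add: symm_unit)
  moreover have "(\<one> (bang\<^sub>o A) \<otimes> munit) \<Zcomp> \<sigma> (bang\<^sub>o A) (bang\<^sub>o \<K>) = munit \<otimes> \<one> (bang\<^sub>o A)"
    using cmp_symm_tens[of "\<one> (bang\<^sub>o A)" munit "bang\<^sub>o A" \<K>] by (simp add: symm_unit)
  ultimately show ?thesis
    using mtens_unit_left[of A] by (simp add: cmp_tail)
qed

lemma mtens_comul:
  assumes [simp]: "A \<in> Ob C" "B \<in> Ob C"
  shows "mtens A B \<Zcomp> \<Delta> (A \<otimes>\<^sub>o B) = seely_comul A B \<Zcomp> (mtens A B \<otimes> mtens A B)"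
  by (simp add: mtens_def bang_naturality seely_coalg_comul[THEN cmp_tail])

text \<open>By \<open>\<delta>_mtens\<close> the right side is
  \<open>seely_coalg A B \<Zcomp> bang (mtens A B)\<close>, which reduces the claim to
  \<open>seely_coalg_\<delta>\<close>.\<close>

lemma mtens_\<delta>:
  assumes [simp]: "A \<in> Ob C" "B \<in> Ob C"
  shows "mtens A B \<Zcomp> \<delta> (A \<otimes>\<^sub>o B) = (\<delta> A \<otimes> \<delta> B) \<Zcomp> (mtens (bang\<^sub>o A) (bang\<^sub>o B) \<Zcomp> bang (mtens A B))"
  by (simp add: \<delta>_mtens[THEN cmp_tail])
    (simp add: mtens_def bang_naturality seely_coalg_\<delta>[THEN cmp_tail])

text \<open>\<open>e A \<Zcomp> u \<K>\<close> is \<open>bang\<close> of a zero map, which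
  naturality moves past \<open>\<delta>\<close> and into \<open>e\<close>.\<close>

lemma bang_e_munit:
  assumes [simp]: "A \<in> Ob C"
  shows "\<delta> A \<Zcomp> bang (e A) = e A \<Zcomp> munit"
proof -
  have "e A \<Zcomp> munit = bang (\<zero> A \<K>) \<Zcomp> (\<delta> \<K> \<Zcomp> bang (e \<K>))"
    by (simp add: munit_def bang_zero)
  also have "\<dots> = \<delta> A \<Zcomp> bang (e A)"
    by (simp add: bang_naturality bang_naturality_tail)
  finally show ?thesis by simp
qed

lemma munit_\<delta>: "munit \<Zcomp> \<delta> \<K> = munit \<Zcomp> bang munit"
proof -
  have "munit \<Zcomp> bang munit = u \<K> \<Zcomp> (\<delta> \<K> \<Zcomp> bang (e \<K> \<Zcomp> munit))"
    by (subst munit_def) simp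
  also have "\<dots> = munit \<Zcomp> \<delta> \<K>"
    by (simp flip: bang_e_munit) (simp add: munit_def bang_naturality \<delta>_\<delta>[THEN cmp_tail])
  finally show ?thesis by simp
qed

section \<open>Tensor products of coalgebras carrying a comultiplication\<close>

definition comonoid_coalg :: "'o \<Rightarrow> 'm \<Rightarrow> 'm \<Rightarrow> 'm \<Rightarrow> bool" where
  "comonoid_coalg P D E p \<longleftrightarrow> counital_comagma P D E \<and> p \<in> hom C P (bang\<^sub>o P)
    \<and> p \<Zcomp> \<delta> P = p \<Zcomp> bang p \<and> p \<Zcomp> \<Delta> P = D \<Zcomp> (p \<otimes> p) \<and> p \<Zcomp> bang E = E \<Zcomp> munit"

lemma comonoid_coalg_bang: "A \<in> Ob C \<Longrightarrow> comonoid_coalg (bang\<^sub>o A) (\<Delta> A) (e A) (\<delta> A)"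
  by (simp add: comonoid_coalg_def counital_comagma_bang \<delta>_\<delta> \<delta>_\<Delta> bang_e_munit)

lemma comonoid_coalgD:
  assumes "comonoid_coalg P D E p"
  shows "counital_comagma P D E" "p \<in> Arr C" "src C p = P" "trg C p = bang\<^sub>o P"
    "p \<Zcomp> \<delta> P = p \<Zcomp> bang p" "p \<Zcomp> \<Delta> P = D \<Zcomp> (p \<otimes> p)" "p \<Zcomp> bang E = E \<Zcomp> munit"
  using assms by (auto simp: comonoid_coalg_def)

context
  fixes P D E p Q D' E' q
  assumes P: "comonoid_coalg P D E p" and Q: "comonoid_coalg Q D' E' q"
begin

private lemmas PQ = comonoid_coalgD[OF P] comonoid_coalgD[OF Q]
private lemmas PQ_type = counital_comagma_type[OF PQ(1)] counital_comagma_type[OF PQ(8)]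
  PQ(2-4) PQ(9-11)

text \<open>The counit is a coalgebra morphism, so the discarded factor becomes \<open>munit\<close>
  and a unit law of \<open>mtens\<close> absorbs it.\<close>

lemma tens_coalg_proj:
  "f \<in> hom C P W \<Longrightarrow> ((p \<otimes> q) \<Zcomp> mtens P Q) \<Zcomp> bang (f \<otimes> E') = (p \<Zcomp> bang f) \<otimes> E'"
  "g \<in> hom C Q W \<Longrightarrow> ((p \<otimes> q) \<Zcomp> mtens P Q) \<Zcomp> bang (E \<otimes> g) = E \<otimes> (q \<Zcomp> bang g)"
proof -
  note [simp] = PQ_type
  assume f: "f \<in> hom C P W"
  then have [simp]: "W \<in> Ob C" by auto
  have "((p \<otimes> q) \<Zcomp> mtens P Q) \<Zcomp> bang (f \<otimes> E') = (p \<otimes> q) \<Zcomp> ((bang f \<otimes> bang E') \<Zcomp> mtens W \<K>)"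
    using f mtens_natural[of f P W E' Q \<K>] by simp
  also have "\<dots> = ((p \<Zcomp> bang f) \<otimes> E') \<Zcomp> ((\<one> (bang\<^sub>o W) \<otimes> munit) \<Zcomp> mtens W \<K>)"
    using f by (simp add: PQ)
  finally show "((p \<otimes> q) \<Zcomp> mtens P Q) \<Zcomp> bang (f \<otimes> E') = (p \<Zcomp> bang f) \<otimes> E'"
    unfolding mtens_unit_right[OF \<open>W \<in> Ob C\<close>] using f by simp
next
  note [simp] = PQ_type
  assume g: "g \<in> hom C Q W"
  then have [simp]: "W \<in> Ob C" by auto
  have "((p \<otimes> q) \<Zcomp> mtens P Q) \<Zcomp> bang (E \<otimes> g) = (p \<otimes> q) \<Zcomp> ((bang E \<otimes> bang g) \<Zcomp> mtens \<K> W)"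
    using g mtens_natural[of E P \<K> g Q W] by simp
  also have "\<dots> = (E \<otimes> (q \<Zcomp> bang g)) \<Zcomp> ((munit \<otimes> \<one> (bang\<^sub>o W)) \<Zcomp> mtens \<K> W)"
    using g by (simp add: PQ)
  finally show "((p \<otimes> q) \<Zcomp> mtens P Q) \<Zcomp> bang (E \<otimes> g) = E \<otimes> (q \<Zcomp> bang g)"
    unfolding mtens_unit_left[OF \<open>W \<in> Ob C\<close>] using g by simp
qed

lemma tens_coalg_comul:
  "((p \<otimes> q) \<Zcomp> mtens P Q) \<Zcomp> \<Delta> (P \<otimes>\<^sub>o Q)
    = comul_tens P Q D D' \<Zcomp> (((p \<otimes> q) \<Zcomp> mtens P Q) \<otimes> ((p \<otimes> q) \<Zcomp> mtens P Q))"
proof -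
  note [simp] = PQ_type
  have "((p \<otimes> q) \<Zcomp> mtens P Q) \<Zcomp> \<Delta> (P \<otimes>\<^sub>o Q)
    = ((p \<otimes> q) \<Zcomp> seely_comul P Q) \<Zcomp> (mtens P Q \<otimes> mtens P Q)"
    by (simp add: mtens_comul)
  also have "(p \<otimes> q) \<Zcomp> seely_comul P Q = comul_tens P Q D D' \<Zcomp> ((p \<otimes> q) \<otimes> (p \<otimes> q))"
    by (rule comul_tens_natural) (auto simp: PQ)
  also have "(comul_tens P Q D D' \<Zcomp> ((p \<otimes> q) \<otimes> (p \<otimes> q))) \<Zcomp> (mtens P Q \<otimes> mtens P Q)
    = comul_tens P Q D D' \<Zcomp> (((p \<otimes> q) \<otimes> (p \<otimes> q)) \<Zcomp> (mtens P Q \<otimes> mtens P Q))"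
    by (rule cmp_assoc_right) auto
  also have "((p \<otimes> q) \<otimes> (p \<otimes> q)) \<Zcomp> (mtens P Q \<otimes> mtens P Q)
    = ((p \<otimes> q) \<Zcomp> mtens P Q) \<otimes> ((p \<otimes> q) \<Zcomp> mtens P Q)"
    by (rule tens_interchange) auto
  finally show ?thesis .
qed

text \<open>Closure under tensor lets the construction be iterated: a factor may itself be a tensor
  product, as the threefold comparison requires.\<close>

lemma comonoid_coalg_tens:
  "comonoid_coalg (P \<otimes>\<^sub>o Q) (comul_tens P Q D D') (E \<otimes> E') ((p \<otimes> q) \<Zcomp> mtens P Q)"
proof -
  note [simp] = PQ_type
  have "((p \<otimes> q) \<Zcomp> mtens P Q) \<Zcomp> \<delta> (P \<otimes>\<^sub>o Q)
    = ((p \<Zcomp> bang p) \<otimes> (q \<Zcomp> bang q)) \<Zcomp> (mtens (bang\<^sub>o P) (bang\<^sub>o Q) \<Zcomp> bang (mtens P Q))"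
    using mtens_\<delta>[of P Q] by (simp add: PQ(5,12)[symmetric])
  also have "\<dots> = (p \<otimes> q) \<Zcomp> (((bang p \<otimes> bang q) \<Zcomp> mtens (bang\<^sub>o P) (bang\<^sub>o Q)) \<Zcomp> bang (mtens P Q))"
    by simp
  also have "(bang p \<otimes> bang q) \<Zcomp> mtens (bang\<^sub>o P) (bang\<^sub>o Q) = mtens P Q \<Zcomp> bang (p \<otimes> q)"
    by (rule mtens_natural) auto
  finally have "((p \<otimes> q) \<Zcomp> mtens P Q) \<Zcomp> \<delta> (P \<otimes>\<^sub>o Q)
    = ((p \<otimes> q) \<Zcomp> mtens P Q) \<Zcomp> bang ((p \<otimes> q) \<Zcomp> mtens P Q)"
    by simp
  moreover have "((p \<otimes> q) \<Zcomp> mtens P Q) \<Zcomp> bang (E \<otimes> E') = (E \<otimes> E') \<Zcomp> munit"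
    by (subst tens_coalg_proj(1)) (auto simp: PQ tens_counit_cmp(2))
  ultimately show ?thesis
    using tens_coalg_comul by (simp add: comonoid_coalg_def counital_comagma_tens PQ)
qed

lemma tens_coalg_bang_add:
  assumes "f \<in> hom C P W" "g \<in> hom C Q W"
  shows "((p \<otimes> q) \<Zcomp> mtens P Q) \<Zcomp> bang ((f \<otimes> E') \<oplus> (E \<otimes> g))
    = ((p \<Zcomp> bang f) \<otimes> (q \<Zcomp> bang g)) \<Zcomp> \<nabla> W"
  by (rule bang_add_comul_tens[OF _ tens_coalg_comul PQ(1,8) _ tens_coalg_proj(1) _ _ tens_coalg_proj(2)])
    (use assms in \<open>auto simp: PQ_type\<close>)

end

section \<open>Associativity through a threefold retraction\<close>

lemma zero_tens [simp]:
  "\<lbrakk>A \<in> Ob C; B \<in> Ob C; h \<in> Arr C\<rbrakk> \<Longrightarrow> \<zero> A B \<otimes> h = \<zero> (A \<otimes>\<^sub>o src C h) (B \<otimes>\<^sub>o trg C h)"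
  "\<lbrakk>A \<in> Ob C; B \<in> Ob C; h \<in> Arr C\<rbrakk> \<Longrightarrow> h \<otimes> \<zero> A B = \<zero> (src C h \<otimes>\<^sub>o A) (trg C h \<otimes>\<^sub>o B)"
  using tens_zero_left[of A B h] tens_zero_right[of h _ _ A B] by auto

text \<open>The retract criterion is applied to both sides with the identity as \<open>h\<close>;
  each side then equals \<open>b \<Zcomp> (\<delta> Z \<Zcomp> bang r)\<close>.\<close>

lemma seely_coalg_assoc:
  assumes [simp]: "A \<in> Ob C" "B \<in> Ob C" "D \<in> Ob C"
  shows "(seely_coalg A B \<otimes> \<delta> D) \<Zcomp> mtens (bang\<^sub>o A \<otimes>\<^sub>o bang\<^sub>o B) (bang\<^sub>o D)
    = (\<delta> A \<otimes> seely_coalg B D) \<Zcomp> mtens (bang\<^sub>o A) (bang\<^sub>o B \<otimes>\<^sub>o bang\<^sub>o D)" (is "?l = ?r")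
proof -
  define Z where "Z = bang\<^sub>o A \<otimes>\<^sub>o (bang\<^sub>o B \<otimes>\<^sub>o bang\<^sub>o D)"
  \<comment> \<open>Threefold injections \<open>i1\<close>, \<open>i2\<close>, \<open>i3\<close> and
    projections \<open>a1\<close>, \<open>a2\<close>, \<open>a3\<close>; their composites again form
    a diagonal matrix.\<close>
  define i1 where "i1 = \<one> (bang\<^sub>o A) \<otimes> (u B \<otimes> u D)"
  define i2 where "i2 = u A \<otimes> (\<one> (bang\<^sub>o B) \<otimes> u D)"
  define i3 where "i3 = u A \<otimes> (u B \<otimes> \<one> (bang\<^sub>o D))"
  define a1 where "a1 = \<epsilon> A \<otimes> (e B \<otimes> e D)"
  define a2 where "a2 = e A \<otimes> (\<epsilon> B \<otimes> e D)"
  define a3 where "a3 = e A \<otimes> (e B \<otimes> \<epsilon> D)"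
  have [simp]: "Z \<in> Ob C" "i1 \<in> Arr C" "src C i1 = bang\<^sub>o A" "trg C i1 = Z"
    "i2 \<in> Arr C" "src C i2 = bang\<^sub>o B" "trg C i2 = Z" "i3 \<in> Arr C" "src C i3 = bang\<^sub>o D" "trg C i3 = Z"
    "a1 \<in> Arr C" "src C a1 = Z" "trg C a1 = A" "a2 \<in> Arr C" "src C a2 = Z" "trg C a2 = B"
    "a3 \<in> Arr C" "src C a3 = Z" "trg C a3 = D"
    by (simp_all add: i1_def i2_def i3_def a1_def a2_def a3_def Z_def)
  have ia: "i1 \<Zcomp> a1 = \<epsilon> A" "i1 \<Zcomp> a2 = \<zero> (bang\<^sub>o A) B" "i1 \<Zcomp> a3 = \<zero> (bang\<^sub>o A) D"
    "i2 \<Zcomp> a1 = \<zero> (bang\<^sub>o B) A" "i2 \<Zcomp> a2 = \<epsilon> B" "i2 \<Zcomp> a3 = \<zero> (bang\<^sub>o B) D"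
    "i3 \<Zcomp> a1 = \<zero> (bang\<^sub>o D) A" "i3 \<Zcomp> a2 = \<zero> (bang\<^sub>o D) B" "i3 \<Zcomp> a3 = \<epsilon> D"
    by (simp_all add: i1_def i2_def i3_def a1_def a2_def a3_def u_e u_\<epsilon>)
  define b where "b = ((((\<delta> A \<Zcomp> bang i1) \<otimes> (\<delta> B \<Zcomp> bang i2)) \<Zcomp> \<nabla> Z) \<otimes> (\<delta> D \<Zcomp> bang i3)) \<Zcomp> \<nabla> Z"
  define r where "r = \<Delta> Z \<Zcomp> ((\<Delta> Z \<Zcomp> (bang a1 \<otimes> bang a2)) \<otimes> bang a3)"
  have [simp]: "b \<in> Arr C" "src C b = Z" "trg C b = bang\<^sub>o Z" "r \<in> Arr C" "src C r = bang\<^sub>o Z" "trg C r = Z"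
    by (simp_all add: b_def r_def) (simp_all add: Z_def)
  define G where "G = comul_tens (bang\<^sub>o A \<otimes>\<^sub>o bang\<^sub>o B) (bang\<^sub>o D) (seely_comul A B) (\<Delta> D)"
  have b_comul: "b \<Zcomp> \<Delta> Z = G \<Zcomp> (b \<otimes> b)"
    unfolding b_def G_def
    by (rule nabla_comul[OF _ nabla_comul[OF _ \<delta>_bang_comul _ _ \<delta>_bang_comul] _ _ \<delta>_bang_comul]) auto
  have b_bang: "b \<Zcomp> bang f = ((((\<delta> A \<Zcomp> bang (i1 \<Zcomp> f)) \<otimes> (\<delta> B \<Zcomp> bang (i2 \<Zcomp> f))) \<Zcomp> \<nabla> W)
      \<otimes> (\<delta> D \<Zcomp> bang (i3 \<Zcomp> f))) \<Zcomp> \<nabla> W" if "f \<in> hom C Z W" for f W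
    using that unfolding b_def by (auto simp: nabla_bang)
  have ba: "b \<Zcomp> bang a1 = (\<one> (bang\<^sub>o A) \<otimes> e B) \<otimes> e D" "b \<Zcomp> bang a2 = (e A \<otimes> \<one> (bang\<^sub>o B)) \<otimes> e D"
    "b \<Zcomp> bang a3 = (e A \<otimes> e B) \<otimes> \<one> (bang\<^sub>o D)"
  proof -
    show "b \<Zcomp> bang a1 = (\<one> (bang\<^sub>o A) \<otimes> e B) \<otimes> e D"
      by (simp add: b_bang[of _ A] ia \<delta>_bang_zero \<delta>_bang_\<epsilon> nabla_unit_cmp del: tens_rules(2))
    show "b \<Zcomp> bang a2 = (e A \<otimes> \<one> (bang\<^sub>o B)) \<otimes> e D"
      by (simp add: b_bang[of _ B] ia \<delta>_bang_zero \<delta>_bang_\<epsilon> nabla_unit_cmp del: tens_rules(2))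
    \<comment> \<open>For the third projection both legs of the inner product are units, so that
      product must first collapse to a single unit.\<close>
    have "((e A \<Zcomp> u D) \<otimes> (e B \<Zcomp> u D)) \<Zcomp> \<nabla> D = (e A \<otimes> e B) \<Zcomp> u D"
      by (subst nabla_unit_cmp) (auto simp: tens_counit_cmp)
    then show "b \<Zcomp> bang a3 = (e A \<otimes> e B) \<otimes> \<one> (bang\<^sub>o D)"
      by (simp add: b_bang[of _ D] ia \<delta>_bang_zero \<delta>_bang_\<epsilon> nabla_unit_cmp del: tens_rules(2))
  qed
  note comagma = counital_comagma_bang[OF assms(1)] counital_comagma_bang[OF assms(2)]
    counital_comagma_bang[OF assms(3)]
  have br: "b \<Zcomp> r = \<one> Z"
  proof -
    have G: "G \<in> hom C Z (Z \<otimes>\<^sub>o Z)"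
      by (simp add: G_def Z_def)
    have "b \<Zcomp> r = G \<Zcomp> ((b \<Zcomp> (\<Delta> Z \<Zcomp> (bang a1 \<otimes> bang a2))) \<otimes> (b \<Zcomp> bang a3))"
      unfolding r_def by (rule comul_pair[OF _ b_comul G]) auto
    also have "b \<Zcomp> (\<Delta> Z \<Zcomp> (bang a1 \<otimes> bang a2)) = G \<Zcomp> ((b \<Zcomp> bang a1) \<otimes> (b \<Zcomp> bang a2))"
      by (rule comul_pair[OF _ b_comul G]) auto
    also have "\<dots> = (seely_comul A B \<Zcomp> ((\<one> (bang\<^sub>o A) \<otimes> e B) \<otimes> (e A \<otimes> \<one> (bang\<^sub>o B)))) \<otimes> e D"
      unfolding ba G_def
      by (rule comul_tens_left[OF counital_comagma_tens[OF comagma(1,2)] comagma(3)]) auto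
    also have "seely_comul A B \<Zcomp> ((\<one> (bang\<^sub>o A) \<otimes> e B) \<otimes> (e A \<otimes> \<one> (bang\<^sub>o B))) = \<one> (bang\<^sub>o A) \<otimes> \<one> (bang\<^sub>o B)"
      by (rule comul_tens_pair[OF comagma(1,2)]) auto
    also have "G \<Zcomp> (((\<one> (bang\<^sub>o A) \<otimes> \<one> (bang\<^sub>o B)) \<otimes> e D) \<otimes> (b \<Zcomp> bang a3))
      = (\<one> (bang\<^sub>o A) \<otimes> \<one> (bang\<^sub>o B)) \<otimes> \<one> (bang\<^sub>o D)"
      unfolding ba G_def
      by (rule comul_tens_pair[OF counital_comagma_tens[OF comagma(1,2)] comagma(3)]) auto
    finally show ?thesis by (simp add: Z_def)
  qed
  note coalg = comonoid_coalg_bang[OF assms(1)] comonoid_coalg_bang[OF assms(2)]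
    comonoid_coalg_bang[OF assms(3)]
  have AB: "comonoid_coalg (bang\<^sub>o A \<otimes>\<^sub>o bang\<^sub>o B) (seely_comul A B) (e A \<otimes> e B) (seely_coalg A B)"
    using comonoid_coalg_tens[OF coalg(1,2)] by (simp add: \<delta>_mtens)
  have BD: "comonoid_coalg (bang\<^sub>o B \<otimes>\<^sub>o bang\<^sub>o D) (seely_comul B D) (e B \<otimes> e D) (seely_coalg B D)"
    using comonoid_coalg_tens[OF coalg(2,3)] by (simp add: \<delta>_mtens)
  \<comment> \<open>The argument of \<open>bang\<close> sums the three injections, bracketed as the
    tensor on this side dictates; evaluation gives \<open>b\<close> directly.\<close>
  have l: "?l \<Zcomp> bang ((((i1 \<otimes> e B) \<oplus> (e A \<otimes> i2)) \<otimes> e D) \<oplus> ((e A \<otimes> e B) \<otimes> i3)) = b"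
    by (subst tens_coalg_bang_add[OF AB coalg(3), of _ Z])
      (auto simp: seely_coalg_bang_add[of A B _ Z] b_def)
  have r: "?r \<Zcomp> bang ((i1 \<otimes> (e B \<otimes> e D)) \<oplus> (e A \<otimes> ((i2 \<otimes> e D) \<oplus> (e B \<otimes> i3)))) = b"
  proof -
    let ?x = "\<delta> A \<Zcomp> bang i1" and ?y = "\<delta> B \<Zcomp> bang i2" and ?z = "\<delta> D \<Zcomp> bang i3"
    have "?r \<Zcomp> bang ((i1 \<otimes> (e B \<otimes> e D)) \<oplus> (e A \<otimes> ((i2 \<otimes> e D) \<oplus> (e B \<otimes> i3))))
      = (?x \<otimes> ((?y \<otimes> ?z) \<Zcomp> \<nabla> Z)) \<Zcomp> \<nabla> Z"
      by (subst tens_coalg_bang_add[OF coalg(1) BD, of _ Z])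
        (auto simp: seely_coalg_bang_add[of B D _ Z])
    also have "\<dots> = (?x \<otimes> (?y \<otimes> ?z)) \<Zcomp> ((\<one> (bang\<^sub>o Z) \<otimes> \<nabla> Z) \<Zcomp> \<nabla> Z)"
      by simp
    \<comment> \<open>The other bracketing multiplies the legs in the other order of association, so
      associativity of \<open>\<nabla>\<close> is what identifies it with \<open>b\<close>.\<close>
    also have "\<dots> = ((?x \<otimes> ?y) \<otimes> ?z) \<Zcomp> ((\<nabla> Z \<otimes> \<one> (bang\<^sub>o Z)) \<Zcomp> \<nabla> Z)"
      by (simp add: nabla_assoc)
    also have "\<dots> = b"
      unfolding b_def by (simp del: tens_rules(2))
    finally show ?thesis .
  qed
  have "\<one> Z \<Zcomp> (b \<Zcomp> (\<delta> Z \<Zcomp> bang r)) = ?l \<Zcomp> bang (\<one> Z)"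
    by (rule coalgebra_mor_retract[OF _ _ _ _ _ br _ trans[OF _ l[symmetric]]])
      (use comonoid_coalgD(5)[OF comonoid_coalg_tens[OF AB coalg(3)]] in \<open>auto simp: Z_def\<close>)
  moreover have "\<one> Z \<Zcomp> (b \<Zcomp> (\<delta> Z \<Zcomp> bang r)) = ?r \<Zcomp> bang (\<one> Z)"
    by (rule coalgebra_mor_retract[OF _ _ _ _ _ br _ trans[OF _ r[symmetric]]])
      (use comonoid_coalgD(5)[OF comonoid_coalg_tens[OF coalg(1) BD]] in \<open>auto simp: Z_def\<close>)
  ultimately show ?thesis
    by (simp add: Z_def)
qed

text \<open>Writing \<open>\<one> (bang\<^sub>o D)\<close> as
  \<open>\<delta> D \<Zcomp> bang (\<epsilon> D)\<close> lets naturality collect all copies of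
  \<open>\<epsilon>\<close> at the end, which leaves \<open>seely_coalg_assoc\<close>; the other
  side is treated likewise.\<close>

lemma mtens_assoc:
  assumes [simp]: "A \<in> Ob C" "B \<in> Ob C" "D \<in> Ob C"
  shows "(mtens A B \<otimes> \<one> (bang\<^sub>o D)) \<Zcomp> mtens (A \<otimes>\<^sub>o B) D = (\<one> (bang\<^sub>o A) \<otimes> mtens B D) \<Zcomp> mtens A (B \<otimes>\<^sub>o D)"
proof -
  let ?\<epsilon> = "bang (\<epsilon> A \<otimes> (\<epsilon> B \<otimes> \<epsilon> D))"
  have "(mtens A B \<otimes> \<one> (bang\<^sub>o D)) \<Zcomp> mtens (A \<otimes>\<^sub>o B) D
    = (seely_coalg A B \<otimes> \<delta> D) \<Zcomp> ((bang (\<epsilon> A \<otimes> \<epsilon> B) \<otimes> bang (\<epsilon> D)) \<Zcomp> mtens (A \<otimes>\<^sub>o B) D)"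
    by (simp add: mtens_def \<delta>_bang_\<epsilon>)
  also have "\<dots> = ((seely_coalg A B \<otimes> \<delta> D) \<Zcomp> mtens (bang\<^sub>o A \<otimes>\<^sub>o bang\<^sub>o B) (bang\<^sub>o D)) \<Zcomp> ?\<epsilon>"
    by (subst mtens_natural[of _ "bang\<^sub>o A \<otimes>\<^sub>o bang\<^sub>o B" _ _ "bang\<^sub>o D"]) auto
  also have "\<dots> = (\<delta> A \<otimes> seely_coalg B D) \<Zcomp> (mtens (bang\<^sub>o A) (bang\<^sub>o B \<otimes>\<^sub>o bang\<^sub>o D) \<Zcomp> ?\<epsilon>)"
    by (subst seely_coalg_assoc) auto
  also have "\<dots> = (\<delta> A \<otimes> seely_coalg B D) \<Zcomp> ((bang (\<epsilon> A) \<otimes> bang (\<epsilon> B \<otimes> \<epsilon> D)) \<Zcomp> mtens A (B \<otimes>\<^sub>o D))"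
    by (subst mtens_natural[of _ "bang\<^sub>o A" _ _ "bang\<^sub>o B \<otimes>\<^sub>o bang\<^sub>o D"]) auto
  also have "\<dots> = (\<one> (bang\<^sub>o A) \<otimes> mtens B D) \<Zcomp> mtens A (B \<otimes>\<^sub>o D)"
    by (simp add: mtens_def \<delta>_bang_\<epsilon>)
  finally show ?thesis .
qed

section \<open>The stated formulas and the axioms\<close>

lemma m_tensor_eq:
  assumes [simp]: "A \<in> Ob C" "B \<in> Ob C"
  shows "m_tensor C bang\<^sub>o bang \<delta> \<epsilon> \<Delta> e \<nabla> u A B = mtens A B"
  by (simp add: m_tensor_def mtens_def seely_coalg_def seely_in_def seely_out_def Let_def)

lemma m_K_eq: "m_K C bang \<delta> e u = munit"
  by (simp add: m_K_def munit_def)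

lemma monoidal_coalgebra_modality_m_tensor:
  "monoidal_coalgebra_modality C bang\<^sub>o bang \<delta> \<epsilon> (m_tensor C bang\<^sub>o bang \<delta> \<epsilon> \<Delta> e \<nabla> u) (m_K C bang \<delta> e u) \<Delta> e"
  \<comment> \<open>\<open>m_K_eq\<close> is unconditional, whereas \<open>m_tensor_eq\<close>
    requires objects and is applied case by case.\<close>
  unfolding m_K_eq
proof (unfold_locales, goal_cases)
  case (1 A B)
  then show ?case by (simp add: m_tensor_eq)
next
  case (2 f A B g A' B')
  then have "A \<in> Ob C" "B \<in> Ob C" "A' \<in> Ob C" "B' \<in> Ob C" by auto
  with 2 show ?case by (simp only: m_tensor_eq mtens_natural)
next
  case 3
  show ?case by simp
next
  case (4 A B D)
  then show ?case by (simp add: m_tensor_eq mtens_assoc)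
next
  case (5 A)
  then show ?case by (simp add: m_tensor_eq mtens_unit_left)
next
  case (6 A)
  then show ?case by (simp add: m_tensor_eq mtens_unit_right)
next
  case (7 A B)
  then show ?case by (simp add: m_tensor_eq mtens_symm)
next
  case (8 A B)
  then show ?case by (simp add: m_tensor_eq mtens_\<delta>)
next
  case 9
  show ?case by (rule munit_\<delta>)
next
  case (10 A B)
  then show ?case by (simp add: m_tensor_eq mtens_def bang_naturality seely_coalg_\<epsilon>[THEN cmp_tail])
next
  case 11
  show ?case by (simp add: munit_def bang_naturality \<delta>_\<epsilon>[THEN cmp_tail] u_e)
next
  case (12 A B)
  then show ?case by (simp add: m_tensor_eq mtens_comul comul_tens_def)
next
  case (13 A B)
  then show ?case by (simp add: m_tensor_eq mtens_def bang_naturality seely_coalg_e)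
next
  case 14
  show ?case
    by (simp add: munit_def bang_naturality \<delta>_\<Delta>[THEN cmp_tail] u_\<Delta>[THEN cmp_tail])
next
  case 15
  show ?case by (simp add: munit_def bang_naturality \<delta>_e u_e)
next
  case (16 A)
  \<comment> \<open>\<open>\<delta>_mtens\<close> turns the tensor of two copies of
    \<open>\<delta>\<close> into \<open>seely_coalg\<close>, so the axiom says that
    \<open>\<Delta>\<close> is a coalgebra morphism.\<close>
  then show ?case by (simp add: m_tensor_eq \<delta>_mtens seely_coalg_\<Delta>)
next
  case (17 A)
  then show ?case by (rule bang_e_munit)
qed

end

theorem proposition3p8:
  fixes C :: "('o, 'm, 'x) additive_smc_data_scheme"
    and bang\<^sub>o :: "'o \<Rightarrow> 'o" and bang :: "'m \<Rightarrow> 'm"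
    and \<delta> \<epsilon> \<Delta> e nabla u :: "'o \<Rightarrow> 'm"
  assumes "additive_bialgebra_modality C bang\<^sub>o bang \<delta> \<epsilon> \<Delta> e nabla u"
  shows "monoidal_coalgebra_modality C bang\<^sub>o bang \<delta> \<epsilon>
    (m_tensor C bang\<^sub>o bang \<delta> \<epsilon> \<Delta> e nabla u) (m_K C bang \<delta> e u) \<Delta> e"
  using assms by (rule additive_bialgebra_modality.monoidal_coalgebra_modality_m_tensor)

end
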